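(* Let $N,d\ge 1$ be integers, let $H\in(0,1)$, and let $X=\{X(t)\}_{t\in\mathbf{R}^N}$ be a $d$-dimensional fractional Brownian motion with Hurst parameter $H$. For every analytic set $E\subseteq\mathbf{R}^N$, $$\dim_{\mathrm P}X(E)=\frac1H\,\mathrm{P}\text{-}\dim_{Hd}E\qquad\text{almost surely},$$ where $\dim_{\mathrm P}$ is packing dimension in $\mathbf{R}^d$, and $\mathrm{P}\text{-}\dim_{Hd}$ is Howroyd's $s$-dimensional packing dimension profile with $s=Hd$.
   Context: $|\cdot|$ denotes the Euclidean norm. **Fractional Brownian motion.** $X(t)=(X_1(t),\ldots,X_d(t))$, $t\in\mathbf{R}^N$, is a centered Gaussian random field with values in $\mathbf{R}^d$ such that for all $u,t\in\mathbf{R}^N$ and $j,k\in\{1,\ldots,d\}$, $$\mathrm{Cov}(X_j(u),X_k(t))=\tfrac12\left(|u|^{2H}+|t|^{2H}-|u-t|^{2H}\right)\delta_{jk},$$ where $\delta_{jk}$ is the Kronecker delta. It is defined on a complete probability space $(\Omega,\mathscr{F},\mathrm{P})$, and $t\mapsto X(t,\omega)$ is continuous for almost every $\omega$. $X(E)=\{X(t):t\in E\}$. **Packing dimension.** For $r>0$ and a bounded set $F\subseteq\mathbf{R}^d$, $N_r(F)$ is the maximum number of disjoint closed balls of radius $r$ with centers in $F$; the upper box dimension is $\mathrm{B}\text{-}\overline{\dim}\,F:=\limsup_{r\downarrow0}\frac{\log N_r(F)}{\log(1/r)}$. For $F\subseteq\mathbf{R}^d$, $$\dim_{\mathrm P}F:=\inf\Big\{\sup_{k\ge1}\mathrm{B}\text{-}\overline{\dim}\,F_k:\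 F\subseteq\bigcup_{k=1}^\infty F_k,\ F_k \text{ bounded}\Big\},$$ with the convention $\dim_{\mathrm P}\varnothing=0$. **Howroyd profile $\mathrm{P}\text{-}\dim_s$.** For $s\in(0,\infty)$ let $\psi_s(x):=\min(1,|x|^{-s})$ for $x\in\mathbf{R}^N$ (so $\psi_s(0)=1$). For $E\subseteq\mathbf{R}^N$ and $\delta>0$, a sequence of triples $(w_i,x_i,r_i)_{i=1}^\infty$ is a $(\psi_s,\delta)$-packing of $E$ if $w_i\ge0$, $x_i\in E$, $0<r_i\le\delta$ for all $i$, and $$\sup_{i\ge1}\sum_{j=1}^\infty w_j\,\psi_s\!\left(\frac{x_i-x_j}{r_j}\right)\le1.$$ For $\alpha>0$ define $$\mathcal{P}_0^{\alpha,s}(E):=\lim_{\delta\downarrow0}\sup\Big\{\sum_{i=1}^\infty w_i(2r_i)^\alpha:\ (w_i,x_i,r_i)_{i=1}^\infty\text{ is a }(\psi_s,\delta)\text{-packing of }E\Big\}$$ (with $\sup\varnothing:=0$), $$\mathcal{P}^{\alpha,s}(E):=\inf\Big\{\sum_{k=1}^\infty\mathcal{P}_0^{\alpha,s}(E_k):\ E\subseteq\bigcup_{k=1}^\infty E_k\Big\},\qquad \mathrm{P}\text{-}\dim_sE:=\inf\{\alpha>0:\ \mathcal{P}^{\alpha,s}(E)=0\}.$$ *)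

theory Defs
  imports "HOL-Probability.Probability"
begin

section \<open>Analytic sets\<close>

text \<open>
  \<^typ>\<open>nat \<Rightarrow> nat\<close> carries the product topology of the discrete topology on \<^typ>\<open>nat\<close>, so it is
  the Baire space. The empty set is analytic but is not an image of the Baire space.
\<close>

definition analytic_set :: "'a::topological_space set \<Rightarrow> bool" where
  "analytic_set E \<longleftrightarrow>
     E = {} \<or> (\<exists>f :: (nat \<Rightarrow> nat) \<Rightarrow> 'a. continuous_on UNIV f \<and> range f = E)"


section \<open>Packing dimension\<close>

text \<open>
  \<open>C\<close> is the set of centers. For \<^prop>\<open>r > 0\<close> and bounded \<open>F\<close> in a Euclidean space the
  cardinalities below are bounded, so that \<^const>\<open>Sup\<close> is their maximum.
\<close>

definition packing_number :: "real \<Rightarrow> 'a::euclidean_space set \<Rightarrow> nat" where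
  "packing_number r F =
     Sup {card C | C. finite C \<and> C \<subseteq> F \<and>
       (\<forall>x\<in>C. \<forall>y\<in>C. x \<noteq> y \<longrightarrow> cball x r \<inter> cball y r = {})}"

text \<open>
  As \<^term>\<open>ln (0::real) = 0\<close>, the empty set gets upper box dimension \<open>0\<close> rather than \<open>-\<infinity>\<close>.
  This does not influence the packing dimension: every cover of a nonempty set has
  a nonempty member, whose upper box dimension is nonnegative.
\<close>

definition upper_box_dim :: "'a::euclidean_space set \<Rightarrow> ereal" where
  "upper_box_dim F =
     Limsup (at_right 0) (\<lambda>r. ereal (ln (real (packing_number r F)) / ln (1 / r)))"

definition packing_dim :: "'a::euclidean_space set \<Rightarrow> ereal" where
  "packing_dim F =
     (if F = {} then 0
      else Inf {(SUP k. upper_box_dim (G k)) | G :: nat \<Rightarrow> 'a set.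
                  F \<subseteq> (\<Union>k. G k) \<and> (\<forall>k. bounded (G k))})"


section \<open>Howroyd's packing dimension profile\<close>

text \<open>The case distinction is needed because \<^term>\<open>0 powr (- s) = (0::real)\<close>.\<close>

definition howroyd_kernel :: "real \<Rightarrow> 'a::euclidean_space \<Rightarrow> real" where
  "howroyd_kernel s x = (if x = 0 then 1 else min 1 (norm x powr (- s)))"

definition howroyd_packing ::
  "real \<Rightarrow> real \<Rightarrow> 'a::euclidean_space set \<Rightarrow>
     (nat \<Rightarrow> real) \<Rightarrow> (nat \<Rightarrow> 'a) \<Rightarrow> (nat \<Rightarrow> real) \<Rightarrow> bool" where
  "howroyd_packing s \<delta> E w x r \<longleftrightarrow>
     (\<forall>i. 0 \<le> w i \<and> x i \<in> E \<and> 0 < r i \<and> r i \<le> \<delta>) \<and>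
     (SUP i. \<Sum>j. ennreal (w j * howroyd_kernel s ((1 / r j) *\<^sub>R (x i - x j)))) \<le> 1"

definition howroyd_sup :: "real \<Rightarrow> real \<Rightarrow> real \<Rightarrow> 'a::euclidean_space set \<Rightarrow> ennreal" where
  "howroyd_sup \<alpha> s \<delta> E =
     Sup {(\<Sum>i. ennreal (w i * (2 * r i) powr \<alpha>)) | w x r. howroyd_packing s \<delta> E w x r}"

definition howroyd_premeasure :: "real \<Rightarrow> real \<Rightarrow> 'a::euclidean_space set \<Rightarrow> ennreal" where
  "howroyd_premeasure \<alpha> s E = Lim (at_right 0) (\<lambda>\<delta>. howroyd_sup \<alpha> s \<delta> E)"

text \<open>The limit exists because \<^const>\<open>howroyd_sup\<close> is nondecreasing in \<open>\<delta>\<close>.\<close>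

lemma howroyd_sup_mono:
  assumes "\<delta> \<le> \<delta>'"
  shows "howroyd_sup \<alpha> s \<delta> E \<le> howroyd_sup \<alpha> s \<delta>' E"
  unfolding howroyd_sup_def
proof (rule Sup_subset_mono)
  have "howroyd_packing s \<delta>' E w x r" if "howroyd_packing s \<delta> E w x r" for w x r
    using that assms by (auto simp: howroyd_packing_def intro: order_trans)
  then show "{(\<Sum>i. ennreal (w i * (2 * r i) powr \<alpha>)) | w x r. howroyd_packing s \<delta> E w x r}
      \<subseteq> {(\<Sum>i. ennreal (w i * (2 * r i) powr \<alpha>)) | w x r. howroyd_packing s \<delta>' E w x r}"
    by blast
qed

lemma howroyd_premeasure_eq_INF:
  "howroyd_premeasure \<alpha> s E = (INF \<delta>\<in>{0<..}. howroyd_sup \<alpha> s \<delta> E)"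
proof -
  have "((\<lambda>\<delta>. howroyd_sup \<alpha> s \<delta> E) \<longlongrightarrow> (INF \<delta>\<in>{0<..}. howroyd_sup \<alpha> s \<delta> E)) (at_right 0)"
  proof (rule order_tendstoI)
    fix a assume a: "a < (INF \<delta>\<in>{0<..}. howroyd_sup \<alpha> s \<delta> E)"
    show "\<forall>\<^sub>F \<delta> in at_right 0. a < howroyd_sup \<alpha> s \<delta> E"
      using eventually_at_right_less[of 0]
      by eventually_elim (rule less_le_trans[OF a], auto intro: INF_lower)
  next
    fix a assume "(INF \<delta>\<in>{0<..}. howroyd_sup \<alpha> s \<delta> E) < a"
    then obtain d where d: "0 < d" "howroyd_sup \<alpha> s d E < a"
      by (auto simp: INF_less_iff)
    have "\<forall>\<^sub>F \<delta> in at_right 0. \<delta> < d"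
      using d(1) by (auto simp: eventually_at_right_field)
    then show "\<forall>\<^sub>F \<delta> in at_right 0. howroyd_sup \<alpha> s \<delta> E < a"
      by eventually_elim (rule le_less_trans[OF howroyd_sup_mono d(2)], simp)
  qed
  then show ?thesis
    unfolding howroyd_premeasure_def by (intro tendsto_Lim) auto
qed

definition howroyd_measure :: "real \<Rightarrow> real \<Rightarrow> 'a::euclidean_space set \<Rightarrow> ennreal" where
  "howroyd_measure \<alpha> s E =
     Inf {(\<Sum>k. howroyd_premeasure \<alpha> s (G k)) | G :: nat \<Rightarrow> 'a set. E \<subseteq> (\<Union>k. G k)}"

definition packing_dim_profile :: "real \<Rightarrow> 'a::euclidean_space set \<Rightarrow> ereal" where
  "packing_dim_profile s E = Inf {ereal \<alpha> | \<alpha>. \<alpha> > 0 \<and> howroyd_measure \<alpha> s E = 0}"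


section \<open>Fractional Brownian motion\<close>

text \<open>Point masses count as Gaussian (for instance \<open>X 0 = 0\<close> almost surely).\<close>

definition gaussian_rv :: "'w measure \<Rightarrow> ('w \<Rightarrow> real) \<Rightarrow> bool" where
  "gaussian_rv M Y \<longleftrightarrow> Y \<in> borel_measurable M \<and>
     (\<exists>\<mu>. (\<exists>\<sigma>>0. distributed M lborel Y (\<lambda>x. ennreal (normal_density \<mu> \<sigma> x))) \<or>
          (AE \<omega> in M. Y \<omega> = \<mu>))"

text \<open>
  Joint Gaussianity of all finite families of coordinates \<open>X\<^sub>j(t)\<close>, expressed through
  their linear combinations.
\<close>

definition gaussian_field ::
  "'w measure \<Rightarrow> ('t \<Rightarrow> 'w \<Rightarrow> 'b::euclidean_space) \<Rightarrow> bool" where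
  "gaussian_field M X \<longleftrightarrow> (\<forall>t. X t \<in> borel_measurable M) \<and>
     (\<forall>T a. finite T \<longrightarrow> gaussian_rv M (\<lambda>\<omega>. \<Sum>t\<in>T. a t \<bullet> X t \<omega>))"

definition cov :: "'w measure \<Rightarrow> ('w \<Rightarrow> real) \<Rightarrow> ('w \<Rightarrow> real) \<Rightarrow> real" where
  "cov M Y Z = integral\<^sup>L M (\<lambda>\<omega>. (Y \<omega> - integral\<^sup>L M Y) * (Z \<omega> - integral\<^sup>L M Z))"

definition fractional_brownian_motion ::
  "real \<Rightarrow> 'w measure \<Rightarrow> (real ^ 'n \<Rightarrow> 'w \<Rightarrow> real ^ 'd) \<Rightarrow> bool" where
  "fractional_brownian_motion H M X \<longleftrightarrow>
     prob_space M \<and> complete_measure M \<and>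
     gaussian_field M X \<and>
     (\<forall>t j. integral\<^sup>L M (\<lambda>\<omega>. X t \<omega> $ j) = 0) \<and>
     (\<forall>u t j k. cov M (\<lambda>\<omega>. X u \<omega> $ j) (\<lambda>\<omega>. X t \<omega> $ k) =
        1 / 2 * (norm u powr (2 * H) + norm t powr (2 * H) - norm (u - t) powr (2 * H)) *
        (if j = k then 1 else 0)) \<and>
     (AE \<omega> in M. continuous_on UNIV (\<lambda>t. X t \<omega>))"

end

theory Submission
  imports Defs
begin

text \<open>
  Put \<open>s = H d\<close>.

  Upper bound: if \<open>X\<close> is \<open>\<gamma>\<close>-Hoelder with \<open>\<gamma> < H\<close>, an \<open>r\<close>-separated subset of \<open>X(F)\<close> pulls back to points
  of \<open>F\<close> which, with constant weights and radius about \<open>r\<^bsup>1/\<gamma>\<^esup>\<close>, form a \<open>\<psi>\<^sub>s\<close>-packing, because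
  \<open>(r / |y - y'|)\<^bsup>s/\<gamma>\<^esup>\<close> is summable over \<open>r\<close>-separated points as soon as \<open>s/\<gamma> > d\<close>.

  Lower bound for one set \<open>F\<close>: a \<open>\<psi>\<^sub>s\<close>-packing of \<open>F\<close> contains, by pigeonholing the radii, weights of
  large total mass \<open>W\<close> at one dyadic scale. Since \<open>P(|X(u) - X(t)| \<le> \<rho>\<^sup>H)\<close> is at most a constant times
  \<open>\<psi>\<^sub>s((u - t) / \<rho>)\<close>, the expected energy of the image weights is \<open>O(W)\<close>, and the Cauchy-Schwarz inequality
  turns a small energy into a large packing number; Borel-Cantelli makes this almost sure.

  Countable covers: let \<open>f\<close> map the Baire space onto \<open>E\<close>. Deleting all basic open sets with null
  image leaves a closed set \<open>T\<close> all of whose nonempty relatively open parts have non-null image. A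
  cover of \<open>X(E)\<close> by closed sets pulls back along \<open>X \<circ> f\<close> to a closed cover of \<open>T\<close>, so by Baire's
  theorem one member contains the image of such a part. As there are countably many basic open
  sets, the lower bound for fixed sets applies to all of them at once.
\<close>

section \<open>Packing numbers and box dimension\<close>

text \<open>Turns the disjointness of balls in \<open>packing_number\<close> into a separation
  condition on the centers, the form used from here on. The inequality is strict because closed
  balls at center distance exactly 2r still share the midpoint.\<close>

lemma disjoint_cball_iff:
  fixes x y :: "'a::euclidean_space"
  assumes "0 \<le> r"
  shows "cball x r \<inter> cball y r = {} \<longleftrightarrow> 2 * r < dist x y"
proof
  assume e: "cball x r \<inter> cball y r = {}"
  show "2 * r < dist x y"
  proof (rule ccontr)
    assume "\<not> 2 * r < dist x y"
    then have "midpoint x y \<in> cball x r \<inter> cball y r"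
      by (simp add: dist_midpoint)
    with e show False by blast
  qed
next
  assume *: "2 * r < dist x y"
  have False if "dist x z \<le> r" "dist y z \<le> r" for z
    using dist_triangle2[of x y z] that * by linarith
  then show "cball x r \<inter> cball y r = {}"
    by auto
qed

text \<open>Volume comparison: the balls of radius \<open>r\<close> about the points are disjoint
  and lie in one ball of radius \<open>R + r\<close>.\<close>

lemma card_separated_le:
  fixes C :: "'a::euclidean_space set"
  assumes C: "finite C" "pairwise (\<lambda>x y. 2 * r < dist x y) C" "C \<subseteq> cball z R"
    and "0 < r" "0 \<le> R"
  shows "real (card C) \<le> (R / r + 1) ^ DIM('a)"
proof -
  let ?V = "unit_ball_vol DIM('a)"
  have "real (card C) * (?V * r ^ DIM('a)) = (\<Sum>x\<in>C. measure lborel (cball x r))"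
    using \<open>0 < r\<close> by (simp add: content_cball)
  also have "\<dots> = measure lborel (\<Union>x\<in>C. cball x r)"
  proof (rule measure_finite_Union[symmetric])
    show "disjoint_family_on (\<lambda>x. cball x r) C"
      using C(2) \<open>0 < r\<close> by (auto simp: disjoint_family_on_def pairwise_def disjoint_cball_iff)
    show "emeasure lborel (cball x r) \<noteq> \<infinity>" for x :: 'a
      using emeasure_lborel_cball_finite[of x r] by simp
  qed (use C in auto)
  also have "\<dots> \<le> measure lborel (cball z (R + r))"
  proof (rule measure_mono_fmeasurable)
    show "(\<Union>x\<in>C. cball x r) \<subseteq> cball z (R + r)"
    proof safe
      fix x y assume "x \<in> C" "y \<in> cball x r"
      then have "dist z x \<le> R" "dist x y \<le> r" using C(3) by auto
      then show "y \<in> cball z (R + r)" using dist_triangle[of z y x] by simp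
    qed
  qed (use C in \<open>auto intro: fmeasurable_compact\<close>)
  also have "\<dots> = ?V * (R + r) ^ DIM('a)"
    using \<open>0 < r\<close> \<open>0 \<le> R\<close> by (simp add: content_cball)
  finally have "?V * (real (card C) * r ^ DIM('a)) \<le> ?V * (R + r) ^ DIM('a)"
    by (simp add: mult_ac)
  then have "real (card C) * r ^ DIM('a) \<le> (R + r) ^ DIM('a)"
    by simp
  then have "real (card C) \<le> (R + r) ^ DIM('a) / r ^ DIM('a)"
    using \<open>0 < r\<close> by (simp add: field_simps)
  also have "\<dots> = (R / r + 1) ^ DIM('a)"
    using \<open>0 < r\<close> by (simp add: power_divide[symmetric] add_divide_distrib)
  finally show ?thesis .
qed

lemma packing_number_eq_Sup_separated:
  fixes F :: "'a::euclidean_space set"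
  assumes "0 < r"
  shows "packing_number r F =
    Sup (card ` {C. finite C \<and> C \<subseteq> F \<and> pairwise (\<lambda>x y. 2 * r < dist x y) C})"
proof -
  have "{card C | C. finite C \<and> C \<subseteq> F \<and>
       (\<forall>x\<in>C. \<forall>y\<in>C. x \<noteq> y \<longrightarrow> cball x r \<inter> cball y r = {})} =
     card ` {C. finite C \<and> C \<subseteq> F \<and> pairwise (\<lambda>x y. 2 * r < dist x y) C}"
    using assms by (auto simp: disjoint_cball_iff pairwise_def image_def)
  then show ?thesis by (simp add: packing_number_def)
qed

text \<open>\<open>Sup\<close> on the naturals is an upper bound only for a bounded set of
  cardinalities; the volume bound supplies this boundedness.\<close>

lemma card_le_packing_number:
  fixes F :: "'a::euclidean_space set"
  assumes "bounded F" "0 < r" "finite C" "C \<subseteq> F" "pairwise (\<lambda>x y. 2 * r < dist x y) C"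
  shows "card C \<le> packing_number r F"
  unfolding packing_number_eq_Sup_separated[OF \<open>0 < r\<close>]
proof (rule cSup_upper)
  obtain R where R: "0 < R" "F \<subseteq> cball 0 R"
    using bounded_subset_ballD[OF \<open>bounded F\<close>, of 0] ball_subset_cball by blast
  have "card D \<le> nat \<lfloor>(R / r + 1) ^ DIM('a)\<rfloor>"
    if "finite D" "D \<subseteq> F" "pairwise (\<lambda>x y. 2 * r < dist x y) D" for D
    using card_separated_le[of D r 0 R] that R \<open>0 < r\<close> by (simp add: le_nat_floor)
  then show "bdd_above (card ` {C. finite C \<and> C \<subseteq> F \<and> pairwise (\<lambda>x y. 2 * r < dist x y) C})"
    by (intro bdd_aboveI[of _ "nat \<lfloor>(R / r + 1) ^ DIM('a)\<rfloor>"]) auto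
qed (use assms in auto)

lemma packing_number_le:
  fixes F :: "'a::euclidean_space set" and B :: real
  assumes "0 < r"
    and "\<And>C. finite C \<Longrightarrow> C \<subseteq> F \<Longrightarrow> pairwise (\<lambda>x y. 2 * r < dist x y) C \<Longrightarrow> real (card C) \<le> B"
  shows "real (packing_number r F) \<le> B"
proof -
  have "0 \<le> B" using assms(2)[of "{}"] by simp
  have "packing_number r F \<le> nat \<lfloor>B\<rfloor>"
    unfolding packing_number_eq_Sup_separated[OF \<open>0 < r\<close>]
    by (rule cSup_least) (auto intro!: exI[of _ "{}"] le_nat_floor assms(2))
  then show ?thesis
    using \<open>0 \<le> B\<close> by linarith
qed

text \<open>Strict separation is an open condition, so a separated finite subset of the closure can
  be moved slightly into \<open>F\<close>. This later allows covers to be replaced by covers with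
  closed sets, as the category argument demands.\<close>

lemma packing_number_closure_le:
  fixes F :: "'a::euclidean_space set"
  assumes "bounded F" "0 < r"
  shows "packing_number r (closure F) \<le> packing_number r F"
proof -
  have "real (packing_number r (closure F)) \<le> real (packing_number r F)"
  proof (rule packing_number_le[OF \<open>0 < r\<close>])
    fix C assume C: "finite C" "C \<subseteq> closure F" "pairwise (\<lambda>x y. 2 * r < dist x y) C"
    \<comment> \<open>Finitely many strict inequalities leave a common slack: each point may move by
      less than \<open>e\<close> and distances still exceed 2r.\<close>
    have "eventually (\<lambda>e. \<forall>x\<in>C. \<forall>y\<in>C. x \<noteq> y \<longrightarrow> 2 * r + 2 * e < dist x y) (at_right 0)"
    proof (intro eventually_ball_finite C ballI)
      fix x y assume "x \<in> C" "y \<in> C"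
      show "\<forall>\<^sub>F e in at_right 0. x \<noteq> y \<longrightarrow> 2 * r + 2 * e < dist x y"
      proof (cases "x = y")
        case False
        then have *: "2 * r < dist x y"
          using C(3) \<open>x \<in> C\<close> \<open>y \<in> C\<close> by (auto simp: pairwise_def)
        have "((\<lambda>e. 2 * r + 2 * e) \<longlongrightarrow> 2 * r + 2 * 0) (at_right 0)"
          by (intro tendsto_intros)
        from order_tendstoD(2)[OF this, of "dist x y"] *
        show ?thesis by (auto elim: eventually_mono)
      qed simp
    qed
    then have "eventually (\<lambda>e. 0 < e \<and> (\<forall>x\<in>C. \<forall>y\<in>C. x \<noteq> y \<longrightarrow> 2 * r + 2 * e < dist x y)) (at_right 0)"
      using eventually_at_right_less[of "0::real"] by (rule eventually_elim2) simp
    from eventually_happens[OF this] obtain e :: real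
      where e: "0 < e" "\<And>x y. x \<in> C \<Longrightarrow> y \<in> C \<Longrightarrow> x \<noteq> y \<Longrightarrow> 2 * r + 2 * e < dist x y"
      by auto
    have "\<forall>x\<in>C. \<exists>y\<in>F. dist y x < e"
      using C(2) e(1) by (auto simp: closure_approachable)
    then obtain p where p: "\<And>x. x \<in> C \<Longrightarrow> p x \<in> F" "\<And>x. x \<in> C \<Longrightarrow> dist (p x) x < e"
      by metis
    have sep: "2 * r < dist (p x) (p y)" if "x \<in> C" "y \<in> C" "x \<noteq> y" for x y
    proof -
      have "dist x y \<le> dist (p x) x + dist (p x) (p y) + dist (p y) y"
        by metric
      then show ?thesis using e(2)[OF that] p(2)[OF that(1)] p(2)[OF that(2)] by linarith
    qed
    then have "inj_on p C"
      using \<open>0 < r\<close> by (intro inj_onI) (smt (verit) dist_self)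
    then have "card C = card (p ` C)"
      by (simp add: card_image)
    also have "\<dots> \<le> packing_number r F"
      using C p sep assms
      by (intro card_le_packing_number) (auto simp: pairwise_image intro: pairwiseI)
    finally show "real (card C) \<le> real (packing_number r F)"
      by simp
  qed
  then show ?thesis by simp
qed

section \<open>Upper box dimension: passage to the closure and bounds from the growth of packing
  numbers\<close>

lemma ln_real_nat_mono:
  "m \<le> n \<Longrightarrow> ln (real m) \<le> ln (real n)"
  by (cases "m = 0"; cases "n = 0") auto

lemma eventually_at_right_0_less: "0 < (a::real) \<Longrightarrow> eventually (\<lambda>r. 0 < r \<and> r < a) (at_right 0)"
  by (auto simp: eventually_at_right_field)

lemma upper_box_dim_closure_le:
  fixes F :: "'a::euclidean_space set"
  assumes "bounded F"
  shows "upper_box_dim (closure F) \<le> upper_box_dim F"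
  unfolding upper_box_dim_def
proof (rule Limsup_mono)
  show "\<forall>\<^sub>F r in at_right 0. ereal (ln (real (packing_number r (closure F))) / ln (1 / r))
      \<le> ereal (ln (real (packing_number r F)) / ln (1 / r))"
    using eventually_at_right_0_less[of 1, OF zero_less_one]
  proof eventually_elim
    case (elim r)
    then show ?case
      using packing_number_closure_le[OF assms, of r]
      by (simp add: divide_right_mono ln_real_nat_mono)
  qed
qed

lemma upper_box_dim_nonneg:
  fixes F :: "'a::euclidean_space set"
  shows "0 \<le> upper_box_dim F"
  unfolding upper_box_dim_def
proof (rule le_Limsup)
  show "\<forall>\<^sub>F r in at_right 0. 0 \<le> ereal (ln (real (packing_number r F)) / ln (1 / r))"
    using eventually_at_right_0_less[of 1, OF zero_less_one]
  proof eventually_elim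
    case (elim r)
    then show ?case
      using ln_real_nat_mono[of 0 "packing_number r F"] by simp
  qed
qed simp

lemma upper_box_dim_le:
  fixes F :: "'a::euclidean_space set"
  assumes ev: "eventually (\<lambda>r. real (packing_number r F) \<le> B * r powr (- t)) (at_right 0)"
    and "0 \<le> t"
  shows "upper_box_dim F \<le> ereal t"
proof -
  \<comment> \<open>Taking \<open>D\<close> at least 1 keeps \<open>ln D\<close> nonnegative; this
    covers packing number 0, where \<open>ln\<close> has its default value 0.\<close>
  define D where "D = max 1 B"
  have D: "1 \<le> D" "B \<le> D" by (auto simp: D_def)
  have "upper_box_dim F \<le> Limsup (at_right 0) (\<lambda>r. ereal (ln D / ln (1 / r) + t))"
    unfolding upper_box_dim_def
  proof (rule Limsup_mono)
    show "\<forall>\<^sub>F r in at_right 0. ereal (ln (real (packing_number r F)) / ln (1 / r))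
        \<le> ereal (ln D / ln (1 / r) + t)"
      using eventually_at_right_0_less[of 1, OF zero_less_one] ev
    proof eventually_elim
      case (elim r)
      have l: "0 < ln (1 / r)" using elim by simp
      have "ln (real (packing_number r F)) \<le> ln D + t * ln (1 / r)"
      proof (cases "packing_number r F = 0")
        case True
        then show ?thesis using D l \<open>0 \<le> t\<close> by simp
      next
        case False
        have "real (packing_number r F) \<le> D * r powr (- t)"
          using elim D(2) by (meson mult_right_mono order_trans powr_ge_zero)
        then have "ln (real (packing_number r F)) \<le> ln (D * r powr (- t))"
          using False by simp
        also have "\<dots> = ln D + t * ln (1 / r)"
          using D elim by (simp add: ln_mult ln_powr ln_div)
        finally show ?thesis .
      qed
      then show ?case
        using l by (simp add: field_simps)
    qed
  qed
  also have "((\<lambda>r::real. ln D / ln (1 / r) + t) \<longlongrightarrow> 0 + t) (at_right 0)"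
  proof (intro tendsto_intros)
    have "filterlim (\<lambda>r::real. 1 / r) at_top (at_right 0)"
      by (simp add: filterlim_inverse_at_top_right flip: inverse_eq_divide)
    then have "filterlim (\<lambda>r::real. ln (1 / r)) at_top (at_right 0)"
      by (rule filterlim_compose[OF ln_at_top])
    then show "((\<lambda>r::real. ln D / ln (1 / r)) \<longlongrightarrow> 0) (at_right 0)"
      by (intro tendsto_divide_0[OF tendsto_const] filterlim_at_top_imp_at_infinity)
  qed
  then have "Limsup (at_right 0) (\<lambda>r. ereal (ln D / ln (1 / r) + t)) = ereal t"
    by (intro lim_imp_Limsup) simp_all
  finally show ?thesis .
qed

text \<open>Split the points into dyadic annuli about \<open>y\<close>. The annulus at distance
  about 2^j r holds O(2^(jd)) points by volume, each contributing at most 2^(-qj), so a geometric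
  series of ratio 2^(d-q) < 1 bounds the sum, uniformly in \<open>r\<close>, \<open>C\<close> and
  \<open>y\<close>.\<close>

lemma sum_separated_powr_le:
  assumes q: "real DIM('a) < q"
  obtains K where "0 \<le> K"
    "\<And>r (C :: 'a::euclidean_space set) y. \<lbrakk>0 < r; finite C; pairwise (\<lambda>x y. 2 * r < dist x y) C; y \<in> C\<rbrakk>
      \<Longrightarrow> (\<Sum>c\<in>C - {y}. (r / dist y c) powr q) \<le> K"
proof -
  let ?d = "DIM('a)"
  define a where "a = 2 powr (real ?d - q)"
  have a: "0 < a" "a < 1"
    using q by (auto simp: a_def powr_less_one)
  have sm: "summable (\<lambda>j. 4 ^ ?d * a ^ j)"
    using a by (intro summable_mult summable_geometric) simp
  define K where "K = (\<Sum>j. 4 ^ ?d * a ^ j)"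
  have "0 \<le> K"
    unfolding K_def using a by (intro suminf_nonneg sm) simp
  moreover have "(\<Sum>c\<in>C - {y}. (r / dist y c) powr q) \<le> K"
    if r: "0 < r" and C: "finite C" "pairwise (\<lambda>x y. 2 * r < dist x y) C" "y \<in> C"
    for r and C :: "'a set" and y
  proof -
    \<comment> \<open>\<open>k c\<close> is the index of the annulus containing \<open>c\<close>.
      Separation makes the ratio exceed 1, so the logarithm is positive and \<open>nat\<close>
      truncates nothing.\<close>
    define k where "k c = nat \<lfloor>log 2 (dist y c / r)\<rfloor>" for c
    have k: "2 ^ k c \<le> dist y c / r" "dist y c / r \<le> 2 ^ (k c + 1)" if c: "c \<in> C - {y}" for c
    proof -
      have "2 * r < dist y c"
        using C c by (auto simp: pairwise_def)
      then have d: "1 < dist y c / r" using r by (simp add: field_simps)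
      then have l: "0 < log 2 (dist y c / r)" by simp
      have "2 ^ k c = 2 powr real (k c)" by (simp add: powr_realpow)
      also have "\<dots> \<le> 2 powr log 2 (dist y c / r)"
        unfolding k_def using l by (intro powr_mono) auto
      also have "\<dots> = dist y c / r" using d by simp
      finally show "2 ^ k c \<le> dist y c / r" .
      have "dist y c / r = 2 powr log 2 (dist y c / r)" using d by simp
      also have "\<dots> \<le> 2 powr real (k c + 1)"
        unfolding k_def using l by (intro powr_mono) linarith+
      also have "\<dots> = 2 ^ (k c + 1)" by (subst powr_realpow) auto
      finally show "dist y c / r \<le> 2 ^ (k c + 1)" .
    qed
    have "(\<Sum>c\<in>C - {y}. (r / dist y c) powr q) \<le> (\<Sum>c\<in>C - {y}. 2 powr (- q * k c))"
    proof (rule sum_mono)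
      fix c assume c: "c \<in> C - {y}"
      have "(r / dist y c) \<le> 2 powr (- real (k c))"
        using k(1)[OF c] r c
        by (simp add: powr_minus powr_realpow field_simps divide_le_eq_1 mult_pos_pos)
      then have "(r / dist y c) powr q \<le> (2 powr (- real (k c))) powr q"
        using q r c by (intro powr_mono2) (auto intro: order.trans[OF _ less_imp_le])
      also have "\<dots> = 2 powr (- q * k c)" by (simp add: powr_powr mult_ac)
      finally show "(r / dist y c) powr q \<le> 2 powr (- q * k c)" .
    qed
    also have "\<dots> = (\<Sum>j\<in>k ` (C - {y}). \<Sum>c\<in>{c. c \<in> C - {y} \<and> k c = j}. 2 powr (- q * k c))"
      using C by (intro sum.image_gen) simp
    also have "\<dots> \<le> (\<Sum>j\<in>k ` (C - {y}). 4 ^ ?d * a ^ j)"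
    proof (rule sum_mono)
      fix j
      let ?D = "{c. c \<in> C - {y} \<and> k c = j}"
      have "real (card ?D) \<le> (2 ^ (j + 1) * r / r + 1) ^ ?d"
      proof (rule card_separated_le)
        show "?D \<subseteq> cball y (2 ^ (j + 1) * r)"
          using k(2) r by (auto simp: field_simps)
      qed (use C r in \<open>auto simp: pairwise_def\<close>)
      \<comment> \<open>Uses 2^(j+1) + 1 <= 4 * 2^j.\<close>
      also have "\<dots> \<le> (4 * 2 ^ j) ^ ?d"
        using r two_realpow_ge_one[of "j + 1"] by (intro power_mono) simp_all
      finally have card: "real (card ?D) \<le> 4 ^ ?d * 2 powr (real ?d * real j)"
        by (simp add: power_mult_distrib powr_realpow[symmetric] powr_powr mult_ac flip: powr_realpow power_mult)
      have "(\<Sum>c\<in>?D. 2 powr (- q * k c)) = real (card ?D) * 2 powr (- q * real j)"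
        by simp
      also have "\<dots> \<le> (4 ^ ?d * 2 powr (real ?d * real j)) * 2 powr (- q * real j)"
        using card by (intro mult_right_mono) auto
      also have "\<dots> = 4 ^ ?d * a ^ j"
        by (simp add: a_def powr_realpow[symmetric] powr_powr powr_add[symmetric] algebra_simps)
      finally show "(\<Sum>c\<in>?D. 2 powr (- q * k c)) \<le> 4 ^ ?d * a ^ j" .
    qed
    also have "\<dots> \<le> K"
      unfolding K_def using a C by (intro sum_le_suminf sm) auto
    finally show ?thesis .
  qed
  ultimately show ?thesis using that by blast
qed

section \<open>The upper bound for Hoelder images\<close>

lemma howroyd_kernel_nonneg: "0 \<le> howroyd_kernel s x"
  by (simp add: howroyd_kernel_def)

lemma howroyd_kernel_le_powr: "x \<noteq> 0 \<Longrightarrow> howroyd_kernel s x \<le> norm x powr (- s)"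
  by (simp add: howroyd_kernel_def)

lemma dist_powr_lower:
  assumes "0 < \<gamma>" "0 < A" "0 \<le> D" "0 \<le> e" "e \<le> A * D powr \<gamma>"
  shows "(e / A) powr (1 / \<gamma>) \<le> (D::real)"
proof -
  have "(e / A) powr (1 / \<gamma>) \<le> (D powr \<gamma>) powr (1 / \<gamma>)"
    using assms by (intro powr_mono2) (auto simp: field_simps)
  also have "\<dots> = D"
    using assms by (simp add: powr_powr)
  finally show ?thesis .
qed

text \<open>The radius \<open>(r / A) powr (1 / \<gamma>)\<close> is the distance at which the
  Hoelder bound equals \<open>r\<close>. Measured in this radius, two preimages are at least
  \<open>(e / r) powr (1 / \<gamma>)\<close> apart when their images have distance \<open>e\<close>;
  this turns the exponent \<open>s\<close> into \<open>s / \<gamma>\<close>.\<close>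

lemma Hoelder_kernel_le:
  fixes h :: "'a::euclidean_space \<Rightarrow> 'b::euclidean_space"
  assumes "0 < \<gamma>" "0 < A" "0 < s" "0 < r"
    and hol: "dist (h x) (h y) \<le> A * dist x y powr \<gamma>" and ne: "h x \<noteq> h y"
  shows "howroyd_kernel s ((1 / (r / A) powr (1 / \<gamma>)) *\<^sub>R (x - y)) \<le> (r / dist (h x) (h y)) powr (s / \<gamma>)"
proof -
  define \<rho> where "\<rho> = (r / A) powr (1 / \<gamma>)"
  define e where "e = dist (h x) (h y)"
  have \<rho>: "0 < \<rho>" using assms by (simp add: \<rho>_def)
  have e: "0 < e" using ne by (simp add: e_def)
  have xy: "x \<noteq> y" using ne by auto
  have "(e / r) powr (1 / \<gamma>) = (e / A) powr (1 / \<gamma>) / \<rho>"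
    using assms e unfolding \<rho>_def by (simp add: powr_divide[symmetric])
  also have "\<dots> \<le> dist x y / \<rho>"
    using dist_powr_lower[of \<gamma> A "dist x y" e] assms \<rho> e
    by (intro divide_right_mono) (auto simp: e_def)
  finally have *: "(e / r) powr (1 / \<gamma>) \<le> dist x y / \<rho>" .
  have "howroyd_kernel s ((1 / \<rho>) *\<^sub>R (x - y)) \<le> (dist x y / \<rho>) powr (- s)"
    using howroyd_kernel_le_powr[of "(1 / \<rho>) *\<^sub>R (x - y)" s] xy \<rho> by (simp add: dist_norm)
  also have "\<dots> \<le> ((e / r) powr (1 / \<gamma>)) powr (- s)"
    using * assms e by (intro powr_mono2') auto
  also have "\<dots> = (e / r) powr (- (s / \<gamma>))"
    by (simp add: powr_powr)
  also have "\<dots> = (r / e) powr (s / \<gamma>)"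
    using assms e by (simp add: powr_minus powr_divide)
  finally show ?thesis unfolding \<rho>_def e_def .
qed

text \<open>Preimages of a separated set \<open>C\<close> in the image form a packing with common
  radius about r^(1/\<gamma>). Since \<open>s / \<gamma>\<close> exceeds the dimension, the row sums
  are at most 1 + K uniformly, so the constant weight 1/(1 + K) is admissible. Its total is at most
  \<open>howroyd_sup\<close>, which bounds \<open>card C\<close> by a multiple of
  r^(-\<alpha>/\<gamma>).\<close>

lemma upper_box_dim_image_le:
  fixes h :: "'a::euclidean_space \<Rightarrow> 'b::euclidean_space"
  assumes \<gamma>: "0 < \<gamma>" and s: "real DIM('b) * \<gamma> < s" and \<alpha>: "0 < \<alpha>" and \<delta>: "0 < \<delta>"
    and fin: "howroyd_sup \<alpha> s \<delta> F < \<infinity>" and A: "0 < A"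
    and hol: "\<And>x y. x \<in> F \<Longrightarrow> y \<in> F \<Longrightarrow> dist (h x) (h y) \<le> A * dist x y powr \<gamma>"
  shows "upper_box_dim (h ` F) \<le> ereal (\<alpha> / \<gamma>)"
proof -
  have spos: "0 < s"
    by (rule le_less_trans[OF _ s]) (use \<gamma> in simp)
  have "real DIM('b) < s / \<gamma>"
    using s \<gamma> by (simp add: field_simps)
  then obtain K where K: "0 \<le> K"
    "\<And>r (C :: 'b set) y. \<lbrakk>0 < r; finite C; pairwise (\<lambda>x y. 2 * r < dist x y) C; y \<in> C\<rbrakk>
      \<Longrightarrow> (\<Sum>c\<in>C - {y}. (r / dist y c) powr (s / \<gamma>)) \<le> K"
    using sum_separated_powr_le by blast
  define L where "L = enn2real (howroyd_sup \<alpha> s \<delta> F)"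
  have L: "howroyd_sup \<alpha> s \<delta> F = ennreal L"
    using fin by (simp add: L_def)
  have L0: "0 \<le> L" by (simp add: L_def)
  have main: "real (card C) \<le> L * (1 + K) * (2 * (r / A) powr (1 / \<gamma>)) powr (- \<alpha>)"
    if r: "0 < r" "(r / A) powr (1 / \<gamma>) \<le> \<delta>"
      and C: "finite C" "C \<subseteq> h ` F" "pairwise (\<lambda>x y. 2 * r < dist x y) C"
    for r C
  proof (cases "C = {}")
    case False
    define \<rho> where "\<rho> = (r / A) powr (1 / \<gamma>)"
    have \<rho>: "0 < \<rho>" using r A by (simp add: \<rho>_def)
    define n where "n = card C"
    have n: "0 < n" using False C by (simp add: n_def card_gt_0_iff)
    obtain e where e: "bij_betw e {..<n} C"
      using ex_bij_betw_nat_finite[OF C(1)] by (auto simp: n_def atLeast0LessThan)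
    have "\<forall>c\<in>C. \<exists>x\<in>F. h x = c" using C(2) by auto
    then obtain g where g: "\<And>c. c \<in> C \<Longrightarrow> g c \<in> F" "\<And>c. c \<in> C \<Longrightarrow> h (g c) = c"
      by metis
    \<comment> \<open>A packing is an infinite sequence of points of \<open>F\<close>, so the
      indices from \<open>n\<close> on repeat the point of index 0 and carry weight 0.\<close>
    define i' where "i' i = (if i < n then i else 0)" for i
    define x where "x i = g (e (i' i))" for i
    define w where "w i = (if i < n then 1 / (1 + K) else 0)" for i
    have i': "i' i < n" for i using n by (simp add: i'_def)
    have eC: "e i \<in> C" if "i < n" for i using e that by (auto simp: bij_betw_def)
    \<comment> \<open>The diagonal term contributes 1, the others at most \<open>K\<close>.\<close>
    have row: "(\<Sum>c\<in>C. howroyd_kernel s ((1 / \<rho>) *\<^sub>R (g y - g c))) \<le> 1 + K" if y: "y \<in> C" for y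
    proof -
      have "(\<Sum>c\<in>C. howroyd_kernel s ((1 / \<rho>) *\<^sub>R (g y - g c))) =
          1 + (\<Sum>c\<in>C - {y}. howroyd_kernel s ((1 / \<rho>) *\<^sub>R (g y - g c)))"
        using y C by (simp add: sum.remove[of C y] howroyd_kernel_def)
      also have "\<dots> \<le> 1 + (\<Sum>c\<in>C - {y}. (r / dist y c) powr (s / \<gamma>))"
      proof (intro add_left_mono sum_mono)
        fix c assume c: "c \<in> C - {y}"
        show "howroyd_kernel s ((1 / \<rho>) *\<^sub>R (g y - g c)) \<le> (r / dist y c) powr (s / \<gamma>)"
          using Hoelder_kernel_le[of \<gamma> A s r h "g y" "g c"] hol[of "g y" "g c"] \<gamma> A spos r g y c
          by (auto simp: \<rho>_def)
      qed
      also have "\<dots> \<le> 1 + K"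
        using K(2)[OF r(1) C(1) C(3) y] by simp
      finally show ?thesis .
    qed
    have pack: "howroyd_packing s \<delta> F w x (\<lambda>_. \<rho>)"
      unfolding howroyd_packing_def
    proof (intro conjI allI SUP_least)
      fix i
      show "0 \<le> w i" using K by (simp add: w_def)
      show "x i \<in> F" unfolding x_def by (intro g eC i')
      have "(\<Sum>j. ennreal (w j * howroyd_kernel s ((1 / \<rho>) *\<^sub>R (x i - x j))))
         = (\<Sum>j<n. ennreal (w j * howroyd_kernel s ((1 / \<rho>) *\<^sub>R (x i - x j))))"
        by (rule suminf_finite) (auto simp: w_def)
      also have "\<dots> = ennreal (\<Sum>j<n. w j * howroyd_kernel s ((1 / \<rho>) *\<^sub>R (x i - x j)))"
        using K by (intro sum_ennreal) (auto simp: w_def howroyd_kernel_nonneg)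
      also have "(\<Sum>j<n. w j * howroyd_kernel s ((1 / \<rho>) *\<^sub>R (x i - x j)))
          = (\<Sum>j<n. howroyd_kernel s ((1 / \<rho>) *\<^sub>R (g (e (i' i)) - g (e j)))) / (1 + K)"
        unfolding sum_divide_distrib by (intro sum.cong) (auto simp: w_def x_def i'_def)
      also have "(\<Sum>j<n. howroyd_kernel s ((1 / \<rho>) *\<^sub>R (g (e (i' i)) - g (e j))))
          = (\<Sum>c\<in>C. howroyd_kernel s ((1 / \<rho>) *\<^sub>R (g (e (i' i)) - g c)))"
        using e by (intro sum.reindex_bij_betw)
      also have "ennreal (\<dots> / (1 + K)) \<le> 1"
        using row[OF eC[OF i'], of i] K by (simp add: ennreal_le_1)
      finally show "(\<Sum>j. ennreal (w j * howroyd_kernel s ((1 / \<rho>) *\<^sub>R (x i - x j)))) \<le> 1" .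
    qed (use \<rho> r \<rho>_def in auto)
    have "ennreal (real n / (1 + K) * (2 * \<rho>) powr \<alpha>) = (\<Sum>i<n. ennreal (w i * (2 * \<rho>) powr \<alpha>))"
      using K by (subst sum_ennreal) (auto simp: w_def)
    also have "\<dots> = (\<Sum>i. ennreal (w i * (2 * \<rho>) powr \<alpha>))"
      by (rule suminf_finite[symmetric]) (auto simp: w_def)
    also have "\<dots> \<le> howroyd_sup \<alpha> s \<delta> F"
      unfolding howroyd_sup_def
      by (intro Sup_upper CollectI exI[of _ w] exI[of _ x] exI[of _ "\<lambda>_. \<rho>"] conjI refl pack)
    finally have "real n / (1 + K) * (2 * \<rho>) powr \<alpha> \<le> L"
      using L0 by (simp add: L)
    then show ?thesis
      using \<rho> K(1) by (simp add: n_def \<rho>_def[symmetric] powr_minus field_simps)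
  qed (use L0 K in simp)
  show ?thesis
  proof (rule upper_box_dim_le)
    \<comment> \<open>The estimate \<open>main\<close> requires the pulled-back radius to be at most
      \<open>\<delta>\<close>, which holds for all small \<open>r\<close>.\<close>
    have "((\<lambda>r. (r / A) powr (1 / \<gamma>)) \<longlongrightarrow> (0 / A) powr (1 / \<gamma>)) (at_right 0)"
      using A \<gamma> by (intro tendsto_powr' tendsto_intros)
        (auto intro!: eventually_mono[OF eventually_at_right_0_less[of 1]])
    then have "eventually (\<lambda>r. (r / A) powr (1 / \<gamma>) < \<delta>) (at_right 0)"
      using \<delta> by (intro order_tendstoD) auto
    then show "\<forall>\<^sub>F r in at_right 0. real (packing_number r (h ` F))
        \<le> L * (1 + K) * 2 powr (- \<alpha>) * A powr (\<alpha> / \<gamma>) * r powr (- (\<alpha> / \<gamma>))"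
      using eventually_at_right_0_less[of 1, OF zero_less_one]
    proof eventually_elim
      case (elim r)
      have "(2 * (r / A) powr (1 / \<gamma>)) powr (- \<alpha>) = 2 powr (- \<alpha>) * (r / A) powr (- (\<alpha> / \<gamma>))"
        using elim A by (simp add: powr_mult powr_powr)
      also have "(r / A) powr (- (\<alpha> / \<gamma>)) = A powr (\<alpha> / \<gamma>) * r powr (- (\<alpha> / \<gamma>))"
        using elim A by (simp add: powr_divide powr_minus field_simps)
      finally show ?case
        using elim main[of r] by (intro packing_number_le) (auto simp: mult_ac)
    qed
  qed (use \<alpha> \<gamma> in simp)
qed

section \<open>Packing dimension of Hoelder images through countable covers\<close>

lemma howroyd_sup_subset: "F \<subseteq> F' \<Longrightarrow> howroyd_sup \<alpha> s \<delta> F \<le> howroyd_sup \<alpha> s \<delta> F'"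
  unfolding howroyd_sup_def by (intro Sup_subset_mono) (force simp: howroyd_packing_def)

lemma packing_dim_nonneg: "0 \<le> packing_dim F"
proof (cases "F = {}")
  case False
  then show ?thesis
    unfolding packing_dim_def
    by (auto intro!: Inf_greatest SUP_upper2[of 0] upper_box_dim_nonneg)
qed (simp add: packing_dim_def)

lemma packing_dim_le:
  assumes "F \<subseteq> (\<Union>k. G k)" "\<And>k::nat. bounded (G k)" "\<And>k. upper_box_dim (G k) \<le> ereal t" "0 \<le> t"
  shows "packing_dim F \<le> ereal t"
proof (cases "F = {}")
  case False
  have "packing_dim F \<le> (SUP k. upper_box_dim (G k))"
    unfolding packing_dim_def using False assms by (auto intro!: Inf_lower)
  also have "\<dots> \<le> ereal t" using assms by (intro SUP_least)
  finally show ?thesis .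
qed (use assms in \<open>simp add: packing_dim_def\<close>)

lemma packing_dim_image_le:
  fixes h :: "'a::euclidean_space \<Rightarrow> 'b::euclidean_space"
  assumes \<gamma>: "0 < \<gamma>" and s: "real DIM('b) * \<gamma> < s" and \<alpha>: "0 < \<alpha>"
    and null: "howroyd_measure \<alpha> s E = 0"
    and hol: "\<And>R. \<exists>A>0. \<forall>x\<in>cball 0 R. \<forall>y\<in>cball 0 R. dist (h x) (h y) \<le> A * dist x y powr \<gamma>"
  shows "packing_dim (h ` E) \<le> ereal (\<alpha> / \<gamma>)"
proof -
  \<comment> \<open>The number 1 only serves as a finite threshold: it forces every piece of the
    cover to have finite \<open>howroyd_sup\<close> for some positive
    \<open>\<delta>\<close>.\<close>
  have "howroyd_measure \<alpha> s E < 1" using null by simp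
  then obtain G where G: "E \<subseteq> (\<Union>k. G k)" "(\<Sum>k. howroyd_premeasure \<alpha> s (G k)) < 1"
    unfolding howroyd_measure_def Inf_less_iff by blast
  have G1: "\<exists>\<delta>>0. howroyd_sup \<alpha> s \<delta> (G k) < 1" for k
  proof -
    have "howroyd_premeasure \<alpha> s (G k) \<le> (\<Sum>k. howroyd_premeasure \<alpha> s (G k))"
      using sum_le_suminf[of "\<lambda>k. howroyd_premeasure \<alpha> s (G k)" "{k}"] by simp
    then have "howroyd_premeasure \<alpha> s (G k) < 1" using G(2) by simp
    then show ?thesis
      by (auto simp: howroyd_premeasure_eq_INF INF_less_iff)
  qed
  \<comment> \<open>Cutting each piece with balls of integer radius gives every part its own Hoelder
    constant and a bounded image; \<open>prod_decode\<close> lists the pairs of piece and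
    radius.\<close>
  define F where "F p = G (fst (prod_decode p)) \<inter> cball 0 (real (snd (prod_decode p)))" for p
  have box: "upper_box_dim (h ` F p) \<le> ereal (\<alpha> / \<gamma>)" and bdd: "bounded (h ` F p)" for p
  proof -
    let ?k = "fst (prod_decode p)" and ?R = "real (snd (prod_decode p))"
    obtain A where A: "A > 0" "\<And>x y. x \<in> cball 0 ?R \<Longrightarrow> y \<in> cball 0 ?R \<Longrightarrow> dist (h x) (h y) \<le> A * dist x y powr \<gamma>"
      using hol[of ?R] by blast
    obtain \<delta> where \<delta>: "\<delta> > 0" "howroyd_sup \<alpha> s \<delta> (G ?k) < 1" using G1 by blast
    have "howroyd_sup \<alpha> s \<delta> (F p) \<le> howroyd_sup \<alpha> s \<delta> (G ?k)"
      by (rule howroyd_sup_subset) (auto simp: F_def)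
    then have "howroyd_sup \<alpha> s \<delta> (F p) < \<infinity>"
      using \<delta>(2) by (metis ennreal_one_less_top infinity_ennreal_def le_less_trans less_trans)
    then show "upper_box_dim (h ` F p) \<le> ereal (\<alpha> / \<gamma>)"
      using A by (intro upper_box_dim_image_le[OF \<gamma> s \<alpha> \<delta>(1) _ A(1)]) (auto simp: F_def)
    show "bounded (h ` F p)"
    proof (rule boundedI)
      fix z assume "z \<in> h ` F p"
      then obtain x where x: "x \<in> cball 0 ?R" "z = h x" by (auto simp: F_def)
      have "norm z \<le> norm (h 0) + dist (h x) (h 0)"
        using norm_triangle_sub[of z "h 0"] by (simp add: x dist_norm)
      also have "dist (h x) (h 0) \<le> A * dist x 0 powr \<gamma>" using x by (intro A) auto
      also have "\<dots> \<le> A * ?R powr \<gamma>"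
        using x A \<gamma> by (intro mult_left_mono powr_mono2) auto
      finally show "norm z \<le> norm (h 0) + A * ?R powr \<gamma>" by simp
    qed
  qed
  have "h ` E \<subseteq> (\<Union>p. h ` F p)"
  proof
    fix z assume "z \<in> h ` E"
    then obtain x k where x: "x \<in> G k" "z = h x" using G(1) by blast
    obtain R :: nat where "norm x \<le> real R" using real_arch_simple by blast
    then have "x \<in> F (prod_encode (k, R))" using x by (simp add: F_def)
    then show "z \<in> (\<Union>p. h ` F p)" using x by blast
  qed
  then show ?thesis
    using bdd box \<alpha> \<gamma> by (intro packing_dim_le[of _ "\<lambda>p. h ` F p"]) auto
qed

section \<open>Gaussian estimates\<close>

context prob_space begin

lemma gaussian_rv_square_integrable:
  assumes "gaussian_rv M Y"
  shows "integrable M (\<lambda>\<omega>. (Y \<omega>)\<^sup>2)"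
proof -
  have [measurable]: "Y \<in> borel_measurable M"
    using assms by (simp add: gaussian_rv_def)
  consider \<mu> \<sigma> where "0 < \<sigma>" "distributed M lborel Y (\<lambda>x. ennreal (normal_density \<mu> \<sigma> x))"
    | \<mu> where "AE \<omega> in M. Y \<omega> = \<mu>"
    using assms by (auto simp: gaussian_rv_def)
  then show ?thesis
  proof cases
    case 1
    have "integrable lborel (\<lambda>x. normal_density \<mu> \<sigma> x * (x - \<mu>)\<^sup>2 +
        (2 * \<mu> * (normal_density \<mu> \<sigma> x * x) + - (\<mu>\<^sup>2) * normal_density \<mu> \<sigma> x))"
      using 1 by (intro Bochner_Integration.integrable_add integrable_mult_right
        integrable_normal_moment integrable_normal_moment_nz_1 integrable_normal_density) auto
    also have "(\<lambda>x. normal_density \<mu> \<sigma> x * (x - \<mu>)\<^sup>2 +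
        (2 * \<mu> * (normal_density \<mu> \<sigma> x * x) + - (\<mu>\<^sup>2) * normal_density \<mu> \<sigma> x)) =
        (\<lambda>x. normal_density \<mu> \<sigma> x * x\<^sup>2)"
      by (auto simp: power2_eq_square algebra_simps)
    finally show ?thesis
      by (subst (asm) distributed_integrable[OF 1(2)]) auto
  next
    case 2
    then have "integrable M (\<lambda>\<omega>. (Y \<omega>)\<^sup>2) \<longleftrightarrow> integrable M (\<lambda>\<omega>. \<mu>\<^sup>2)"
      by (intro integrable_cong_AE) auto
    then show ?thesis by simp
  qed
qed

text \<open>The first two moments determine the parameters of a Gaussian law, and a positive second
  moment excludes the point mass at 0.\<close>

lemma gaussian_rv_centered_distributed:
  assumes Y: "gaussian_rv M Y" and "expectation Y = 0" "expectation (\<lambda>\<omega>. (Y \<omega>)\<^sup>2) = \<sigma>\<^sup>2" "0 < \<sigma>"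
  shows "distributed M lborel Y (\<lambda>x. ennreal (normal_density 0 \<sigma> x))"
proof -
  have [measurable]: "Y \<in> borel_measurable M"
    using Y by (simp add: gaussian_rv_def)
  consider \<mu> \<tau> where "0 < \<tau>" "distributed M lborel Y (\<lambda>x. ennreal (normal_density \<mu> \<tau> x))"
    | \<mu> where "AE \<omega> in M. Y \<omega> = \<mu>"
    using Y by (auto simp: gaussian_rv_def)
  then show ?thesis
  proof cases
    case 1
    have "\<mu> = 0"
      using normal_distributed_expectation[OF 1] assms by simp
    moreover have "\<tau>\<^sup>2 = \<sigma>\<^sup>2"
      using normal_distributed_variance[OF 1] assms by simp
    ultimately show ?thesis
      using 1 \<open>0 < \<sigma>\<close> by (simp add: power2_eq_iff)
  next
    case 2
    then have "expectation Y = expectation (\<lambda>\<omega>. \<mu>)"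
      by (intro integral_cong_AE) auto
    then have "\<mu> = 0" using assms by (simp add: prob_space)
    then have "expectation (\<lambda>\<omega>. (Y \<omega>)\<^sup>2) = expectation (\<lambda>\<omega>. 0)"
      using 2 by (intro integral_cong_AE) auto
    then show ?thesis using assms by simp
  qed
qed

text \<open>Markov's inequality for the moment of order 2k. The order stays free so that it can
  later be chosen large enough to beat the number of grid points.\<close>

lemma centered_normal_tail:
  assumes Y: "distributed M lborel Y (\<lambda>x. ennreal (normal_density 0 \<sigma> x))" and "0 < \<sigma>" "0 < c"
  shows "prob {\<omega> \<in> space M. c \<le> \<bar>Y \<omega>\<bar>} \<le> fact (2 * k) / (2 ^ k * fact k) * (\<sigma> / c) ^ (2 * k)"
proof -
  have [measurable]: "Y \<in> borel_measurable M"
    using distributed_measurable[OF Y] by simp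
  have "integrable lborel (\<lambda>x. normal_density 0 \<sigma> x * x ^ (2 * k))"
    using integrable_normal_moment[OF \<open>0 < \<sigma>\<close>, of 0 "2 * k"] by simp
  then have int: "integrable M (\<lambda>\<omega>. Y \<omega> ^ (2 * k))"
    by (subst (asm) distributed_integrable[OF Y]) auto
  have eq: "expectation (\<lambda>\<omega>. Y \<omega> ^ (2 * k)) = fact (2 * k) / (2 ^ k * fact k) * \<sigma> ^ (2 * k)"
  proof -
    have "expectation (\<lambda>\<omega>. Y \<omega> ^ (2 * k)) = (LINT x|lborel. normal_density 0 \<sigma> x * x ^ (2 * k))"
      using distributed_integral[OF Y, of "\<lambda>x. x ^ (2 * k)"] by simp
    also have "\<dots> = fact (2 * k) / ((2 / \<sigma>\<^sup>2) ^ k * fact k)"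
      using integral_normal_moment_even[OF \<open>0 < \<sigma>\<close>, of 0 k] by simp
    also have "(2 / \<sigma>\<^sup>2) ^ k = 2 ^ k / \<sigma> ^ (2 * k)"
      by (simp add: power_divide flip: power_mult)
    finally show ?thesis by simp
  qed
  have "prob {\<omega> \<in> space M. c \<le> \<bar>Y \<omega>\<bar>} = prob {\<omega> \<in> space M. c ^ (2 * k) \<le> Y \<omega> ^ (2 * k)}" if "0 < k"
  proof -
    have "c \<le> \<bar>y\<bar> \<longleftrightarrow> c ^ (2 * k) \<le> y ^ (2 * k)" for y
      using power_mono_iff[of c "\<bar>y\<bar>" "2 * k"] \<open>0 < c\<close> that by (simp add: power_even_abs)
    then show ?thesis by simp
  qed
  also have "prob {\<omega> \<in> space M. c ^ (2 * k) \<le> Y \<omega> ^ (2 * k)} \<le> 1 / c ^ (2 * k) * expectation (\<lambda>\<omega>. Y \<omega> ^ (2 * k))"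
    using integral_Markov_inequality_measure[OF int, of "{}" "c ^ (2 * k)"] \<open>0 < c\<close> by simp
  also have "\<dots> = fact (2 * k) / (2 ^ k * fact k) * (\<sigma> / c) ^ (2 * k)"
  proof -
    have "1 / C * (F / G * S) = F / G * (S / C)" for C F G S :: real
      by (simp add: field_simps)
    then show ?thesis unfolding eq power_divide .
  qed
  \<comment> \<open>The chain assumed k > 0, since for k = 0 both powers are 1; there the claim is
    that a probability is at most 1.\<close>
  finally show ?thesis
    by (cases "k = 0") auto
qed

text \<open>The characteristic function at 1, by scaling to the standard normal law. Applied to
  inner products with a vector, it yields the characteristic function of the vector-valued
  variable.\<close>

lemma expectation_iexp_centered_normal:
  assumes Y: "distributed M lborel Y (\<lambda>x. ennreal (normal_density 0 \<sigma> x))" and "0 < \<sigma>"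
  shows "(CLINT \<omega>|M. iexp (Y \<omega>)) = complex_of_real (exp (- (\<sigma>\<^sup>2 / 2)))"
proof -
  have [measurable]: "Y \<in> borel_measurable M"
    using distributed_measurable[OF Y] by simp
  have "distributed M lborel (\<lambda>\<omega>. (Y \<omega> - 0) / \<sigma>) (\<lambda>x. ennreal (std_normal_density x))"
    using normal_standard_normal_convert[of \<sigma> Y 0] Y \<open>0 < \<sigma>\<close> by simp
  then have d: "distr M lborel (\<lambda>\<omega>. Y \<omega> / \<sigma>) = std_normal_distribution"
    by (simp add: distributed_def)
  have "(CLINT \<omega>|M. iexp (Y \<omega>)) = (CLINT \<omega>|M. iexp (\<sigma> * (Y \<omega> / \<sigma>)))"
    using \<open>0 < \<sigma>\<close> by simp
  also have "\<dots> = (CLINT x|distr M lborel (\<lambda>\<omega>. Y \<omega> / \<sigma>). iexp (\<sigma> * x))"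
    by (rule integral_distr[symmetric]) auto
  also have "\<dots> = char std_normal_distribution \<sigma>"
    by (simp add: d char_def)
  finally show ?thesis by (simp add: char_std_normal_distribution)
qed

end

section \<open>Small ball probabilities of isotropic Gaussian vectors\<close>

lemma integral_std_normal_exp_square:
  "(LINT x|std_normal_distribution. exp (- ((c * x)\<^sup>2 / 2))) = 1 / sqrt (1 + c\<^sup>2)"
proof -
  \<comment> \<open>The inverse variances 1 and c^2 add up: the standard density times the
    exponential is \<open>\<tau>\<close> times the normal density with standard deviation
    \<open>\<tau>\<close>.\<close>
  define \<tau> where "\<tau> = 1 / sqrt (1 + c\<^sup>2)"
  have c: "0 < 1 + c\<^sup>2" by (simp add: add_pos_nonneg)
  then have \<tau>: "0 < \<tau>" by (simp add: \<tau>_def)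
  have \<tau>2: "\<tau>\<^sup>2 = 1 / (1 + c\<^sup>2)" using c by (simp add: \<tau>_def power_divide)
  have "(LINT x|std_normal_distribution. exp (- ((c * x)\<^sup>2 / 2)))
      = (LINT x|lborel. std_normal_density x * exp (- ((c * x)\<^sup>2 / 2)))"
    by (subst integral_density) auto
  also have "\<dots> = (LINT x|lborel. \<tau> * normal_density 0 \<tau> x)"
  proof (intro Bochner_Integration.integral_cong refl)
    fix x :: real
    have "exp (- x\<^sup>2 / 2) * exp (- ((c * x)\<^sup>2 / 2)) = exp (- x\<^sup>2 / (2 * \<tau>\<^sup>2))"
      using c unfolding exp_add[symmetric] \<tau>2 by (simp add: field_simps)
    moreover have "sqrt (2 * pi * \<tau>\<^sup>2) = sqrt (2 * pi) * \<tau>"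
      using \<tau> by (simp add: real_sqrt_mult)
    ultimately show "std_normal_density x * exp (- ((c * x)\<^sup>2 / 2)) = \<tau> * normal_density 0 \<tau> x"
      using \<tau> by (simp add: normal_density_def field_simps)
  qed
  also have "\<dots> = \<tau>" using \<tau> by simp
  finally show ?thesis by (simp add: \<tau>_def)
qed

lemma norm_vec_square: "(norm (z :: real ^ 'd))\<^sup>2 = (\<Sum>j\<in>UNIV. (z $ j)\<^sup>2)"
  unfolding power2_norm_eq_inner inner_vec_def by (simp add: power2_eq_square)

lemma borel_measurable_vec_component [measurable (raw)]:
  "f \<in> borel_measurable M \<Longrightarrow> (\<lambda>x. f x $ j) \<in> borel_measurable M"
  by (rule measurable_compose[of f M borel "\<lambda>y. y $ j"])
    (auto intro!: borel_measurable_continuous_onI continuous_intros)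

text \<open>The function exp(-|z|^2/(2r^2)) is the characteristic function of \<xi>/r, where \<xi>
  has independent standard normal coordinates on an auxiliary space. Exchanging the integrals over
  \<omega> and \<xi> leaves only the laws of the linear functionals of \<open>Z\<close>, and the
  mean of exp(-|Z|^2/(2r^2)) becomes (1 + (\<sigma>/r)^2)^(-d/2), at most (r/\<sigma>)^d.\<close>

lemma (in prob_space) isotropic_gaussian_small_ball:
  fixes Z :: "'a \<Rightarrow> real ^ 'd"
  assumes [measurable]: "Z \<in> borel_measurable M" and "0 < \<sigma>" "0 < r"
    and Z: "\<And>a. a \<noteq> 0 \<Longrightarrow> distributed M lborel (\<lambda>\<omega>. a \<bullet> Z \<omega>) (\<lambda>x. ennreal (normal_density 0 (\<sigma> * norm a) x))"
  shows "prob {\<omega> \<in> space M. norm (Z \<omega>) \<le> r} \<le> exp (1 / 2) * (r / \<sigma>) ^ CARD('d)"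
proof -
  define N where "N = std_normal_distribution"
  interpret N: prob_space N
    unfolding N_def by (rule prob_space_normal_density) simp
  interpret P: product_prob_space "\<lambda>_::'d. N" UNIV ..
  define P where "P = Pi\<^sub>M (UNIV :: 'd set) (\<lambda>_. N)"
  interpret P2: prob_space P
    unfolding P_def by (rule P.prob_space_axioms)
  interpret MP: pair_prob_space M P ..
  have setsN [measurable_cong]: "sets N = sets borel"
    by (simp add: N_def)
  have setsP: "sets P = sets (Pi\<^sub>M UNIV (\<lambda>_. borel))"
    unfolding P_def by (intro sets_PiM_cong refl setsN)
  have [measurable]: "(\<lambda>\<xi>. \<xi> j) \<in> borel_measurable P" for j
    unfolding measurable_cong_sets[OF setsP refl] by measurable
  define a where "a \<xi> = (\<chi> j. \<xi> j / r)" for \<xi> :: "'d \<Rightarrow> real"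
  have inner_a: "a \<xi> \<bullet> z = (\<Sum>j\<in>UNIV. z $ j / r * \<xi> j)" for \<xi> z
    by (simp add: a_def inner_vec_def mult_ac)
  have norm_a: "\<sigma>\<^sup>2 * (norm (a \<xi>))\<^sup>2 = (\<Sum>j\<in>UNIV. ((\<sigma> / r) * \<xi> j)\<^sup>2)" for \<xi>
    by (simp add: norm_vec_square a_def sum_distrib_left power_divide power_mult_distrib)
  have fourier: "(CLINT \<xi>|P. iexp (a \<xi> \<bullet> z)) = complex_of_real (exp (- ((norm z)\<^sup>2 / (2 * r\<^sup>2))))" for z
  proof -
    have meas: "(\<lambda>x. iexp (c * x)) \<in> borel_measurable N" for c
      unfolding measurable_cong_sets[OF setsN refl] by measurable
    have int: "integrable N (\<lambda>x. iexp (c * x))" for c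
      by (rule N.integrable_const_bound[of _ 1, OF _ meas]) simp
    have "(CLINT \<xi>|P. iexp (a \<xi> \<bullet> z)) = (CLINT \<xi>|P. (\<Prod>j\<in>UNIV. iexp (z $ j / r * \<xi> j)))"
      by (simp add: inner_a exp_sum sum_distrib_left)
    also have "\<dots> = (\<Prod>j\<in>UNIV. CLINT x|N. iexp (z $ j / r * x))"
      unfolding P_def by (rule P.product_integral_prod[OF finite int])
    also have "\<dots> = (\<Prod>j\<in>UNIV. char N (z $ j / r))"
      by (simp add: char_def)
    also have "\<dots> = complex_of_real (\<Prod>j\<in>UNIV. exp (- ((z $ j / r)\<^sup>2) / 2))"
      by (simp add: N_def char_std_normal_distribution)
    also have "(\<Prod>j\<in>UNIV. exp (- ((z $ j / r)\<^sup>2) / 2)) = exp (- ((norm z)\<^sup>2 / (2 * r\<^sup>2)))"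
      by (simp add: exp_sum[symmetric] norm_vec_square sum_negf sum_divide_distrib power_divide mult_ac)
    finally show ?thesis .
  qed
  have gauss: "(CLINT \<omega>|M. iexp (a \<xi> \<bullet> Z \<omega>)) = complex_of_real (exp (- (\<sigma>\<^sup>2 * (norm (a \<xi>))\<^sup>2 / 2)))" for \<xi>
  proof (cases "a \<xi> = 0")
    case False
    then show ?thesis
      using expectation_iexp_centered_normal[OF Z[OF False]] \<open>0 < \<sigma>\<close> by (simp add: power_mult_distrib)
  qed (simp add: prob_space)
  have [measurable]: "(\<lambda>(\<omega>, \<xi>). iexp (a \<xi> \<bullet> Z \<omega>)) \<in> borel_measurable (M \<Otimes>\<^sub>M P)"
    unfolding inner_a by measurable
  have intMP: "integrable (M \<Otimes>\<^sub>M P) (\<lambda>(\<omega>, \<xi>). iexp (a \<xi> \<bullet> Z \<omega>))"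
    by (rule MP.integrable_const_bound[of _ 1]) auto
  have "complex_of_real (LINT \<omega>|M. exp (- ((norm (Z \<omega>))\<^sup>2 / (2 * r\<^sup>2)))) =
      (CLINT \<omega>|M. CLINT \<xi>|P. iexp (a \<xi> \<bullet> Z \<omega>))"
    unfolding fourier by (rule integral_complex_of_real[symmetric])
  also have "\<dots> = (CLINT \<xi>|P. CLINT \<omega>|M. iexp (a \<xi> \<bullet> Z \<omega>))"
    by (rule MP.Fubini_integral[OF intMP, symmetric])
  also have "\<dots> = complex_of_real (LINT \<xi>|P. exp (- (\<sigma>\<^sup>2 * (norm (a \<xi>))\<^sup>2 / 2)))"
    unfolding gauss by (rule integral_complex_of_real)
  also have "(LINT \<xi>|P. exp (- (\<sigma>\<^sup>2 * (norm (a \<xi>))\<^sup>2 / 2)))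
      = (LINT \<xi>|P. (\<Prod>j\<in>UNIV. exp (- (((\<sigma> / r) * \<xi> j)\<^sup>2 / 2))))"
    unfolding norm_a by (simp add: exp_sum[symmetric] sum_negf sum_divide_distrib)
  also have "\<dots> = (\<Prod>j\<in>(UNIV :: 'd set). LINT x|N. exp (- (((\<sigma> / r) * x)\<^sup>2 / 2)))"
    unfolding P_def
  proof (rule P.product_integral_prod[OF finite])
    have "(\<lambda>x. exp (- (((\<sigma> / r) * x)\<^sup>2 / 2))) \<in> borel_measurable N"
      unfolding measurable_cong_sets[OF setsN refl] by measurable
    then show "integrable N (\<lambda>x. exp (- (((\<sigma> / r) * x)\<^sup>2 / 2)))"
      by (rule N.integrable_const_bound[of _ 1, rotated]) simp
  qed
  also have "\<dots> = (1 / sqrt (1 + (\<sigma> / r)\<^sup>2)) ^ CARD('d)"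
    unfolding N_def integral_std_normal_exp_square by simp
  finally have E: "(LINT \<omega>|M. exp (- ((norm (Z \<omega>))\<^sup>2 / (2 * r\<^sup>2)))) = (1 / sqrt (1 + (\<sigma> / r)\<^sup>2)) ^ CARD('d)"
    by (simp only: of_real_eq_iff)
  have "\<sigma> / r \<le> sqrt (1 + (\<sigma> / r)\<^sup>2)"
    by (rule real_le_rsqrt) simp
  then have "1 / sqrt (1 + (\<sigma> / r)\<^sup>2) \<le> 1 / (\<sigma> / r)"
    using \<open>0 < \<sigma>\<close> \<open>0 < r\<close> by (intro divide_left_mono mult_pos_pos) (auto intro: add_pos_nonneg)
  then have "(1 / sqrt (1 + (\<sigma> / r)\<^sup>2)) ^ CARD('d) \<le> (r / \<sigma>) ^ CARD('d)"
    by (intro power_mono) auto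
  then have Ele: "(LINT \<omega>|M. exp (- ((norm (Z \<omega>))\<^sup>2 / (2 * r\<^sup>2)))) \<le> (r / \<sigma>) ^ CARD('d)"
    by (simp add: E)
  \<comment> \<open>On the small ball event the exponential is at least exp(-1/2), so Markov's
    inequality applies; this is the source of the factor exp(1/2).\<close>
  have "prob {\<omega> \<in> space M. norm (Z \<omega>) \<le> r}
      \<le> prob {\<omega> \<in> space M. exp (- (1 / 2)) \<le> exp (- ((norm (Z \<omega>))\<^sup>2 / (2 * r\<^sup>2)))}"
  proof (rule finite_measure_mono)
    have "norm z \<le> r \<Longrightarrow> (norm z)\<^sup>2 \<le> r\<^sup>2" for z :: "real ^ 'd"
      by (intro power_mono) auto
    then show "{\<omega> \<in> space M. norm (Z \<omega>) \<le> r}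
       \<subseteq> {\<omega> \<in> space M. exp (- (1 / 2)) \<le> exp (- ((norm (Z \<omega>))\<^sup>2 / (2 * r\<^sup>2)))}"
      using \<open>0 < r\<close> by (auto simp: field_simps)
  qed simp
  also have "\<dots> \<le> (LINT \<omega>|M. exp (- ((norm (Z \<omega>))\<^sup>2 / (2 * r\<^sup>2)))) / exp (- (1 / 2))"
  proof (rule integral_Markov_inequality_measure[where A = "{}"])
    show "integrable M (\<lambda>\<omega>. exp (- ((norm (Z \<omega>))\<^sup>2 / (2 * r\<^sup>2))))"
      by (rule integrable_const_bound[of _ 1]) auto
  qed auto
  also have "\<dots> \<le> exp (1 / 2) * (r / \<sigma>) ^ CARD('d)"
  proof -
    have "x / exp (- (1 / 2)) = exp (1 / 2) * x" for x :: real
      by (simp add: exp_minus field_simps)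
    then show ?thesis using Ele by simp
  qed
  finally show ?thesis .
qed

lemma integrable_mult_of_square_integrable:
  fixes f g :: "'a \<Rightarrow> real"
  assumes [measurable]: "f \<in> borel_measurable M" "g \<in> borel_measurable M"
    and "integrable M (\<lambda>x. (f x)\<^sup>2)" "integrable M (\<lambda>x. (g x)\<^sup>2)"
  shows "integrable M (\<lambda>x. f x * g x)"
proof (rule Bochner_Integration.integrable_bound)
  show "integrable M (\<lambda>x. (f x)\<^sup>2 + (g x)\<^sup>2)"
    using assms by simp
  have "\<bar>a * b\<bar> \<le> a\<^sup>2 + b\<^sup>2" for a b :: real
  proof -
    have "0 \<le> (\<bar>a\<bar> - \<bar>b\<bar>)\<^sup>2" "0 \<le> a\<^sup>2 + b\<^sup>2" by auto
    moreover have "0 \<le> \<bar>a\<bar> * \<bar>b\<bar>" by simp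
    ultimately show ?thesis unfolding power2_diff abs_mult power2_abs by linarith
  qed
  then show "AE x in M. norm (f x * g x) \<le> norm ((f x)\<^sup>2 + (g x)\<^sup>2)"
    by (auto intro!: order_trans[OF _ abs_ge_self])
qed simp

section \<open>Moments and laws of the increments of fractional Brownian motion\<close>

context
  fixes H :: real and M :: "'w measure" and X :: "real ^ 'n \<Rightarrow> 'w \<Rightarrow> real ^ 'd"
  assumes H: "0 < H" and X: "fractional_brownian_motion H M X"
begin

interpretation prob_space M
  using X by (simp add: fractional_brownian_motion_def)

lemma fbm_measurable: "X t \<in> borel_measurable M"
  using X by (simp add: fractional_brownian_motion_def gaussian_field_def)

lemma fbm_component_mean: "expectation (\<lambda>\<omega>. X t \<omega> $ j) = 0"
  using X by (simp add: fractional_brownian_motion_def)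

lemma fbm_gaussian_rv: "finite T \<Longrightarrow> gaussian_rv M (\<lambda>\<omega>. \<Sum>t\<in>T. a t \<bullet> X t \<omega>)"
  using X by (simp add: fractional_brownian_motion_def gaussian_field_def)

lemma fbm_component_square_integrable: "integrable M (\<lambda>\<omega>. (X t \<omega> $ j)\<^sup>2)"
  using gaussian_rv_square_integrable[OF fbm_gaussian_rv[of "{t}" "\<lambda>_. axis j 1"]]
  by (simp add: inner_axis')

lemma fbm_component_integrable: "integrable M (\<lambda>\<omega>. X t \<omega> $ j)"
proof -
  note [measurable] = fbm_measurable
  show ?thesis
    by (rule square_integrable_imp_integrable) (use fbm_component_square_integrable in auto)
qed

lemma fbm_component_product_integrable: "integrable M (\<lambda>\<omega>. X u \<omega> $ j * X t \<omega> $ k)"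
proof -
  note [measurable] = fbm_measurable
  show ?thesis
    by (intro integrable_mult_of_square_integrable fbm_component_square_integrable) auto
qed

lemma fbm_component_product_mean:
  "expectation (\<lambda>\<omega>. X u \<omega> $ j * X t \<omega> $ k) =
    1 / 2 * (norm u powr (2 * H) + norm t powr (2 * H) - norm (u - t) powr (2 * H)) * (if j = k then 1 else 0)"
proof -
  have "cov M (\<lambda>\<omega>. X u \<omega> $ j) (\<lambda>\<omega>. X t \<omega> $ k) = expectation (\<lambda>\<omega>. X u \<omega> $ j * X t \<omega> $ k)"
    by (simp add: cov_def fbm_component_mean)
  then show ?thesis
    using X unfolding fractional_brownian_motion_def by metis
qed

lemma fbm_increment_product_integrable:
  "integrable M (\<lambda>\<omega>. (X u \<omega> $ j - X t \<omega> $ j) * (X u \<omega> $ k - X t \<omega> $ k))"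
  unfolding left_diff_distrib right_diff_distrib
  by (intro Bochner_Integration.integrable_diff fbm_component_product_integrable)

text \<open>On expanding the product, the terms in |u| and |t| cancel and only |u - t|
  survives.\<close>

lemma fbm_increment_product_mean:
  "expectation (\<lambda>\<omega>. (X u \<omega> $ j - X t \<omega> $ j) * (X u \<omega> $ k - X t \<omega> $ k)) =
     norm (u - t) powr (2 * H) * (if j = k then 1 else 0)"
  unfolding left_diff_distrib right_diff_distrib
  by (simp add: fbm_component_product_integrable fbm_component_product_mean norm_minus_commute[of t u])
     (simp add: field_simps)

text \<open>A linear functional of an increment is a linear combination of two values of the field,
  hence Gaussian. Distinct coordinates are uncorrelated with equal variances, so its variance
  depends on \<open>a\<close> only through the norm of \<open>a\<close>.\<close>

lemma fbm_increment_distributed: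
  assumes "u \<noteq> t" "a \<noteq> 0"
  shows "distributed M lborel (\<lambda>\<omega>. a \<bullet> (X u \<omega> - X t \<omega>))
    (\<lambda>x. ennreal (normal_density 0 (norm (u - t) powr H * norm a) x))"
proof (rule gaussian_rv_centered_distributed)
  have "gaussian_rv M (\<lambda>\<omega>. \<Sum>s\<in>{u, t}. (if s = u then a else - a) \<bullet> X s \<omega>)"
    by (rule fbm_gaussian_rv) simp
  then show "gaussian_rv M (\<lambda>\<omega>. a \<bullet> (X u \<omega> - X t \<omega>))"
    using \<open>u \<noteq> t\<close> by (simp add: inner_diff_right)
  have eq: "a \<bullet> (X u \<omega> - X t \<omega>) = (\<Sum>j\<in>UNIV. a $ j * (X u \<omega> $ j - X t \<omega> $ j))" for \<omega>
    by (simp add: inner_vec_def)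
  show "expectation (\<lambda>\<omega>. a \<bullet> (X u \<omega> - X t \<omega>)) = 0"
    unfolding eq by (simp add: fbm_component_integrable fbm_component_mean)
  have eq2: "(a \<bullet> (X u \<omega> - X t \<omega>))\<^sup>2 = (\<Sum>j\<in>UNIV. \<Sum>k\<in>UNIV.
      a $ j * a $ k * ((X u \<omega> $ j - X t \<omega> $ j) * (X u \<omega> $ k - X t \<omega> $ k)))" for \<omega>
    unfolding eq power2_eq_square sum_product by (intro sum.cong refl) (simp only: mult_ac)
  have "expectation (\<lambda>\<omega>. (a \<bullet> (X u \<omega> - X t \<omega>))\<^sup>2) =
      (\<Sum>j\<in>UNIV. \<Sum>k\<in>UNIV. a $ j * a $ k * (norm (u - t) powr (2 * H) * (if j = k then 1 else 0)))"
    unfolding eq2 by (simp add: fbm_increment_product_integrable fbm_increment_product_mean)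
  also have "\<dots> = (\<Sum>j\<in>UNIV. \<Sum>k\<in>UNIV. if j = k then norm (u - t) powr (2 * H) * (a $ j * a $ j) else 0)"
    by (intro sum.cong refl) auto
  also have "\<dots> = norm (u - t) powr (2 * H) * (norm a)\<^sup>2"
    unfolding norm_vec_square by (simp add: sum_distrib_left power2_eq_square)
  also have "\<dots> = (norm (u - t) powr H * norm a)\<^sup>2"
    by (simp add: power_mult_distrib power2_eq_square powr_add[symmetric])
  finally show "expectation (\<lambda>\<omega>. (a \<bullet> (X u \<omega> - X t \<omega>))\<^sup>2) = (norm (u - t) powr H * norm a)\<^sup>2" .
qed (use assms in simp)

lemma fbm_small_ball:
  assumes "u \<noteq> t" "0 < r"
  shows "prob {\<omega> \<in> space M. dist (X u \<omega>) (X t \<omega>) \<le> r} \<le> exp (1 / 2) * (r / norm (u - t) powr H) ^ CARD('d)"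
proof -
  note [measurable] = fbm_measurable
  show ?thesis
    unfolding dist_norm using assms fbm_increment_distributed[OF \<open>u \<noteq> t\<close>]
    by (intro isotropic_gaussian_small_ball) auto
qed

lemma fbm_component_tail:
  assumes "0 < c"
  shows "prob {\<omega> \<in> space M. c \<le> \<bar>X u \<omega> $ j - X t \<omega> $ j\<bar>}
    \<le> fact (2 * k) / (2 ^ k * fact k) * (norm (u - t) powr H / c) ^ (2 * k)"
proof (cases "u = t")
  case True
  then show ?thesis using assms by simp
next
  case False
  have "distributed M lborel (\<lambda>\<omega>. X u \<omega> $ j - X t \<omega> $ j) (\<lambda>x. ennreal (normal_density 0 (norm (u - t) powr H) x))"
    using fbm_increment_distributed[OF False, of "axis j 1"] by (simp add: inner_axis' axis_eq_0_iff)
  then show ?thesis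
    using False assms by (intro centered_normal_tail) auto
qed

end

section \<open>Hoelder continuity of the sample paths\<close>

definition dyadic_point :: "nat \<Rightarrow> ('n \<Rightarrow> int) \<Rightarrow> real ^ 'n" where
  "dyadic_point m z = (\<chi> i. real_of_int (z i) / 2 ^ m)"

definition dyadic_floor :: "nat \<Rightarrow> real ^ 'n \<Rightarrow> 'n \<Rightarrow> int" where
  "dyadic_floor m x i = \<lfloor>2 ^ m * x $ i\<rfloor>"

definition dyadic_box :: "nat \<Rightarrow> nat \<Rightarrow> ('n \<Rightarrow> int) set" where
  "dyadic_box R m = PiE UNIV (\<lambda>_. {- (int (R + 1) * 2 ^ m)..int (R + 1) * 2 ^ m})"

text \<open>Index differences with entries -1, 0, 1. They serve both for neighbours on one level and
  for the correction between the approximations of a point on consecutive levels.\<close>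

definition dyadic_steps :: "('n \<Rightarrow> int) set" where
  "dyadic_steps = PiE UNIV (\<lambda>_. {-1..1})"

lemma finite_dyadic_box: "finite (dyadic_box R m :: ('n::finite \<Rightarrow> int) set)"
  unfolding dyadic_box_def by (intro finite_PiE) auto

lemma finite_dyadic_steps: "finite (dyadic_steps :: ('n::finite \<Rightarrow> int) set)"
  unfolding dyadic_steps_def by (intro finite_PiE) auto

lemma card_dyadic_box:
  "real (card (dyadic_box R m :: ('n::finite \<Rightarrow> int) set)) \<le> (real (2 * R + 3) * 2 ^ m) ^ CARD('n)"
proof -
  have "card (dyadic_box R m :: ('n \<Rightarrow> int) set) = nat (2 * (int (R + 1) * 2 ^ m) + 1) ^ CARD('n)"
    by (simp add: dyadic_box_def card_PiE algebra_simps)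
  moreover have "real (nat (2 * (int (R + 1) * 2 ^ m) + 1)) \<le> real (2 * R + 3) * 2 ^ m"
    using two_realpow_ge_one[of m] by (simp add: algebra_simps)
  ultimately show ?thesis
    by (simp add: power_mono)
qed

lemma card_dyadic_steps: "card (dyadic_steps :: ('n::finite \<Rightarrow> int) set) = 3 ^ CARD('n)"
  by (simp add: dyadic_steps_def card_PiE)

lemma norm_dyadic_step_le:
  fixes e :: "'n::finite \<Rightarrow> int"
  assumes "e \<in> dyadic_steps"
  shows "norm (dyadic_point m z - dyadic_point m (\<lambda>i. z i + e i)) \<le> real CARD('n) / 2 ^ m"
proof -
  have "norm (dyadic_point m z - dyadic_point m (\<lambda>i. z i + e i)) \<le>
      (\<Sum>i\<in>UNIV. \<bar>(dyadic_point m z - dyadic_point m (\<lambda>i. z i + e i)) $ i\<bar>)"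
    by (rule norm_le_l1_cart)
  also have "\<dots> \<le> (\<Sum>i\<in>(UNIV :: 'n set). 1 / 2 ^ m)"
  proof (rule sum_mono)
    fix i
    have "- 1 \<le> e i \<and> e i \<le> 1" using assms by (auto simp: dyadic_steps_def PiE_def Pi_def)
    then have "\<bar>real_of_int (e i)\<bar> \<le> 1" by linarith
    then show "\<bar>(dyadic_point m z - dyadic_point m (\<lambda>i. z i + e i)) $ i\<bar> \<le> 1 / 2 ^ m"
      by (simp add: dyadic_point_def diff_divide_distrib[symmetric] divide_right_mono)
  qed
  finally show ?thesis by simp
qed

lemma dyadic_floor_in_box:
  assumes "norm (x :: real ^ 'n::finite) \<le> real R"
  shows "dyadic_floor m x \<in> dyadic_box R m"
proof -
  have "- (int (R + 1) * 2 ^ m) \<le> \<lfloor>2 ^ m * x $ i\<rfloor> \<and> \<lfloor>2 ^ m * x $ i\<rfloor> \<le> int (R + 1) * 2 ^ m" for i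
  proof -
    have "\<bar>x $ i\<bar> \<le> real R"
      using component_le_norm_cart[of x i] assms by linarith
    then have "\<bar>2 ^ m * x $ i\<bar> \<le> 2 ^ m * real R"
      by (simp add: abs_mult)
    then have *: "- (2 ^ m * real R) \<le> 2 ^ m * x $ i" "2 ^ m * x $ i \<le> 2 ^ m * real R"
      by linarith+
    have "real_of_int (int (R + 1) * 2 ^ m) = 2 ^ m * real R + 2 ^ m"
      by (simp add: algebra_simps)
    then show ?thesis
      using * two_realpow_ge_one[of m] by (intro conjI) (linarith, linarith)
  qed
  then show ?thesis by (auto simp: dyadic_box_def dyadic_floor_def)
qed

text \<open>A grid point of level m with index z lies on level m + 1 with index 2z, and the
  difference of 2\<lfloor>y\<rfloor> and \<lfloor>2y\<rfloor> is at most 1 in absolute value. Hence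
  consecutive approximations of a point differ by one step of the finer grid.\<close>

lemma dyadic_floor_refine:
  "dyadic_point m (dyadic_floor m x) =
     dyadic_point (Suc m) (\<lambda>i. dyadic_floor (Suc m) x i + (2 * dyadic_floor m x i - dyadic_floor (Suc m) x i))"
  "(\<lambda>i. 2 * dyadic_floor m x i - dyadic_floor (Suc m) x i) \<in> dyadic_steps"
proof -
  show "dyadic_point m (dyadic_floor m x) =
     dyadic_point (Suc m) (\<lambda>i. dyadic_floor (Suc m) x i + (2 * dyadic_floor m x i - dyadic_floor (Suc m) x i))"
    by (simp add: dyadic_point_def)
  have "2 * \<lfloor>y\<rfloor> - \<lfloor>2 * y\<rfloor> \<in> {-1..1}" for y :: real
    by (auto simp: floor_le_iff le_floor_iff) linarith+
  then have "2 * \<lfloor>2 ^ m * x $ i\<rfloor> - \<lfloor>2 ^ Suc m * x $ i\<rfloor> \<in> {-1..1}" for i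
    by (metis mult.assoc power_Suc)
  then show "(\<lambda>i. 2 * dyadic_floor m x i - dyadic_floor (Suc m) x i) \<in> dyadic_steps"
    by (auto simp: dyadic_steps_def dyadic_floor_def PiE_UNIV_domain)
qed

lemma dyadic_floor_close:
  assumes "dist x y \<le> 1 / 2 ^ m"
  shows "(\<lambda>i. dyadic_floor m y i - dyadic_floor m x i) \<in> dyadic_steps"
proof -
  have "\<lfloor>2 ^ m * y $ i\<rfloor> - \<lfloor>2 ^ m * x $ i\<rfloor> \<in> {-1..1}" for i
  proof -
    have "\<bar>y $ i - x $ i\<bar> \<le> 1 / 2 ^ m"
      using component_le_norm_cart[of "y - x" i] assms by (simp add: dist_norm norm_minus_commute)
    then have "2 ^ m * \<bar>y $ i - x $ i\<bar> \<le> 1"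
      by (simp add: field_simps)
    moreover have "\<bar>2 ^ m * y $ i - 2 ^ m * x $ i\<bar> = 2 ^ m * \<bar>y $ i - x $ i\<bar>"
      by (simp add: abs_mult flip: right_diff_distrib)
    ultimately have "\<bar>2 ^ m * y $ i - 2 ^ m * x $ i\<bar> \<le> 1"
      by simp
    then show ?thesis by simp linarith
  qed
  then show ?thesis by (auto simp: dyadic_steps_def dyadic_floor_def PiE_UNIV_domain)
qed

lemma dyadic_floor_tendsto: "(\<lambda>m. dyadic_point m (dyadic_floor m x)) \<longlonglongrightarrow> x"
proof (rule vec_tendstoI)
  fix i
  have "(\<lambda>m. x $ i - (1 / 2) ^ m) \<longlonglongrightarrow> x $ i - 0"
    by (intro tendsto_intros) simp
  then have lo: "(\<lambda>m. x $ i - (1 / 2) ^ m) \<longlonglongrightarrow> x $ i" by simp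
  have "x $ i - (1 / 2) ^ m \<le> dyadic_point m (dyadic_floor m x) $ i" for m
  proof -
    have "(2 ^ m * x $ i - 1) / 2 ^ m \<le> real_of_int \<lfloor>2 ^ m * x $ i\<rfloor> / 2 ^ m"
      by (intro divide_right_mono) (linarith, simp)
    then show ?thesis
      by (simp add: dyadic_point_def dyadic_floor_def diff_divide_distrib power_one_over)
  qed
  moreover have "dyadic_point m (dyadic_floor m x) $ i \<le> x $ i" for m
    using floor_correct[of "2 ^ m * x $ i"]
    by (simp add: dyadic_point_def dyadic_floor_def field_simps)
  ultimately show "(\<lambda>m. dyadic_point m (dyadic_floor m x) $ i) \<longlonglongrightarrow> x $ i"
    by (intro tendsto_sandwich[OF _ _ lo tendsto_const]) auto
qed

text \<open>Chaining: the approximations of a point converge to it with increments that decay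
  geometrically, so by continuity h(x) differs from its value at the approximation of level m by
  O(\<theta>^m). Two points within 2^(-m) have neighbouring approximations, and \<theta>^m is
  comparable to the distance to the power \<gamma> when m is chosen maximal.\<close>

lemma Hoelder_of_dyadic_increments:
  fixes h :: "real ^ 'n \<Rightarrow> real ^ 'd"
  assumes cont: "continuous_on UNIV h" and \<gamma>: "0 < \<gamma>"
    and ev: "eventually (\<lambda>m. \<forall>z\<in>dyadic_box R m. \<forall>e\<in>dyadic_steps. \<forall>j.
      \<bar>h (dyadic_point m z) $ j - h (dyadic_point m (\<lambda>i. z i + e i)) $ j\<bar> \<le> (2 powr (- \<gamma>)) ^ m) sequentially"
  shows "\<exists>A>0. \<forall>x\<in>cball 0 (real R). \<forall>y\<in>cball 0 (real R). dist (h x) (h y) \<le> A * dist x y powr \<gamma>"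
proof -
  define \<theta> where "\<theta> = 2 powr (- \<gamma>)"
  have \<theta>: "0 < \<theta>" "\<theta> < 1"
    using \<gamma> by (auto simp: \<theta>_def powr_less_one)
  define d where "d = real CARD('d)"
  have d: "0 < d" by (simp add: d_def)
  obtain m0 where m0: "\<And>m z e j. m \<ge> m0 \<Longrightarrow> z \<in> dyadic_box R m \<Longrightarrow> e \<in> dyadic_steps \<Longrightarrow>
      \<bar>h (dyadic_point m z) $ j - h (dyadic_point m (\<lambda>i. z i + e i)) $ j\<bar> \<le> \<theta> ^ m"
    using ev unfolding eventually_sequentially \<theta>_def by blast
  have step: "dist (h (dyadic_point m z)) (h (dyadic_point m (\<lambda>i. z i + e i))) \<le> d * \<theta> ^ m"
    if "m \<ge> m0" "z \<in> dyadic_box R m" "e \<in> dyadic_steps" for m z e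
  proof -
    have "dist (h (dyadic_point m z)) (h (dyadic_point m (\<lambda>i. z i + e i))) \<le>
       (\<Sum>j\<in>UNIV. \<bar>(h (dyadic_point m z) - h (dyadic_point m (\<lambda>i. z i + e i))) $ j\<bar>)"
      unfolding dist_norm by (rule norm_le_l1_cart)
    also have "\<dots> \<le> (\<Sum>j\<in>(UNIV :: 'd set). \<theta> ^ m)"
      using m0[OF that] by (intro sum_mono) simp
    finally show ?thesis by (simp add: d_def)
  qed
  define p where "p m x = dyadic_point m (dyadic_floor m x)" for m and x :: "real ^ 'n"
  have chain: "dist (h (p m x)) (h (p (Suc m) x)) \<le> d * \<theta> ^ m"
    if "m \<ge> m0" "norm x \<le> R" for m x
  proof -
    have "dist (h (p (Suc m) x)) (h (p m x)) \<le> d * \<theta> ^ Suc m"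
      unfolding p_def dyadic_floor_refine(1)[of m x]
      by (rule step[OF _ dyadic_floor_in_box dyadic_floor_refine(2)]) (use that in auto)
    also have "\<dots> \<le> d * \<theta> ^ m"
      using d \<theta> by (intro mult_left_mono power_decreasing) auto
    finally show ?thesis by (simp add: dist_commute)
  qed
  have sums: "(\<lambda>i. d * \<theta> ^ m * \<theta> ^ i) sums (d * \<theta> ^ m * (1 / (1 - \<theta>)))" for m
    using \<theta> by (intro sums_mult geometric_sums) auto
  have approx: "dist (h (p m x)) (h x) \<le> d * \<theta> ^ m * (1 / (1 - \<theta>))"
    if mx: "m \<ge> m0" "norm x \<le> R" for m x
  proof (rule tendsto_upperbound)
    have "(\<lambda>n. p n x) \<longlonglongrightarrow> x"
      unfolding p_def by (rule dyadic_floor_tendsto)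
    then have "(\<lambda>n. h (p n x)) \<longlonglongrightarrow> h x"
      using cont by (metis continuous_on_tendsto_compose UNIV_I eventually_sequentiallyI)
    then have "(\<lambda>n. h (p (n + m) x)) \<longlonglongrightarrow> h x"
      by (rule LIMSEQ_ignore_initial_segment)
    then show "(\<lambda>n. dist (h (p m x)) (h (p (n + m) x))) \<longlonglongrightarrow> dist (h (p m x)) (h x)"
      by (intro tendsto_intros)
    have "dist (h (p m x)) (h (p (n + m) x)) \<le> (\<Sum>i<n. d * \<theta> ^ m * \<theta> ^ i)" for n
    proof (induction n)
      case (Suc n)
      have "dist (h (p m x)) (h (p (Suc n + m) x)) \<le>
          dist (h (p m x)) (h (p (n + m) x)) + dist (h (p (n + m) x)) (h (p (Suc (n + m)) x))"
        using dist_triangle by simp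
      also have "dist (h (p (n + m) x)) (h (p (Suc (n + m)) x)) \<le> d * \<theta> ^ (n + m)"
        by (rule chain) (use mx in auto)
      finally show ?case using Suc by (simp add: power_add mult_ac)
    qed simp
    also have "(\<Sum>i<n. d * \<theta> ^ m * \<theta> ^ i) \<le> d * \<theta> ^ m * (1 / (1 - \<theta>))" for n
      using sum_le_suminf[OF sums_summable[OF sums], of "{..<n}" m] sums_unique[OF sums, of m] d \<theta> by simp
    finally show "\<forall>\<^sub>F n in sequentially. dist (h (p m x)) (h (p (n + m) x)) \<le> d * \<theta> ^ m * (1 / (1 - \<theta>))"
      by simp
  qed simp
  \<comment> \<open>One step between neighbouring grid points plus two tails of the geometric
    series.\<close>
  define B where "B = d * (1 + 2 / (1 - \<theta>))"
  have B: "0 < B" using d \<theta> by (simp add: B_def add_pos_pos)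
  have near: "dist (h x) (h y) \<le> B * \<theta> ^ m"
    if m: "m \<ge> m0" and xy: "norm x \<le> R" "norm y \<le> R" "dist x y \<le> 1 / 2 ^ m" for m x y
  proof -
    have "dyadic_floor m y = (\<lambda>i. dyadic_floor m x i + (dyadic_floor m y i - dyadic_floor m x i))"
      by simp
    then have "p m y = dyadic_point m (\<lambda>i. dyadic_floor m x i + (dyadic_floor m y i - dyadic_floor m x i))"
      unfolding p_def by simp
    then have "dist (h (p m x)) (h (p m y)) \<le> d * \<theta> ^ m"
      using step[OF m dyadic_floor_in_box[OF xy(1)] dyadic_floor_close[OF xy(3)]] unfolding p_def by simp
    moreover have "dist (h x) (h y) \<le> dist (h (p m x)) (h x) + dist (h (p m x)) (h (p m y)) + dist (h (p m y)) (h y)"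
      by metric
    ultimately have "dist (h x) (h y) \<le> d * \<theta> ^ m * (1 / (1 - \<theta>)) + d * \<theta> ^ m + d * \<theta> ^ m * (1 / (1 - \<theta>))"
      using approx[OF m xy(1)] approx[OF m xy(2)] by linarith
    also have "\<dots> = B * \<theta> ^ m"
      by (simp add: B_def algebra_simps)
    finally show ?thesis .
  qed
  have "bounded (h ` cball 0 (real R))"
    by (intro compact_imp_bounded compact_continuous_image continuous_on_subset[OF cont]) auto
  then obtain b where b: "0 < b" "\<And>x. norm x \<le> R \<Longrightarrow> norm (h x) \<le> b"
    unfolding bounded_pos by auto
  \<comment> \<open>The first summand serves pairs within 2^(-m0). The second serves more distant
    pairs, through the bound \<open>b\<close> for |h| on the ball.\<close>
  define A where "A = B / \<theta> + 2 * b * (2 ^ m0) powr \<gamma>"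
  have A: "B / \<theta> \<le> A" "2 * b * (2 ^ m0) powr \<gamma> \<le> A" "0 < A"
    using B b \<theta> by (auto simp: A_def add_pos_nonneg)
  have "dist (h x) (h y) \<le> A * dist x y powr \<gamma>" if xy: "norm x \<le> R" "norm y \<le> R" for x y
  proof (cases "x = y")
    case False
    define D where "D = dist x y"
    have D: "0 < D" using False by (simp add: D_def)
    show ?thesis
    proof (cases "D \<le> 1 / 2 ^ m0")
      case True
      \<comment> \<open>The largest m with \<open>D\<close> at most 2^(-m). Then \<open>D\<close>
        exceeds or equals 2^(-m-1), and the loss of one level costs the factor 1/\<theta>.\<close>
      define m where "m = nat \<lfloor>log 2 (1 / D)\<rfloor>"
      have "2 ^ m0 \<le> 1 / D" using True D by (simp add: field_simps)
      then have l: "real m0 \<le> log 2 (1 / D)"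
        using D by (simp add: le_log_iff powr_realpow)
      then have "m0 \<le> m" by (simp add: m_def le_nat_floor)
      have "real m \<le> log 2 (1 / D)" "log 2 (1 / D) \<le> real m + 1"
        unfolding m_def using l by linarith+
      then have m: "2 powr real m \<le> 1 / D" "1 / D \<le> 2 powr (real m + 1)"
        using D by (simp_all add: le_log_iff log_le_iff)
      then have "D \<le> 1 / 2 ^ m"
        using D by (simp add: powr_realpow field_simps)
      then have "dist (h x) (h y) \<le> B * \<theta> ^ m"
        using near[OF \<open>m0 \<le> m\<close> xy] by (simp add: D_def)
      also have "\<theta> ^ m = (2 powr (real m + 1)) powr (- \<gamma>) / \<theta>"
        by (simp add: \<theta>_def powr_realpow[symmetric] powr_powr powr_diff[symmetric] algebra_simps)
      also have "\<dots> \<le> (1 / D) powr (- \<gamma>) / \<theta>"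
        using m D \<gamma> \<theta> by (intro divide_right_mono powr_mono2') auto
      also have "(1 / D) powr (- \<gamma>) = D powr \<gamma>"
        using D by (simp add: powr_divide powr_minus)
      finally have "dist (h x) (h y) \<le> B / \<theta> * D powr \<gamma>"
        using B by simp
      also have "\<dots> \<le> A * D powr \<gamma>"
        by (intro mult_right_mono A) simp
      finally show ?thesis by (simp add: D_def)
    next
      case False
      then have "1 \<le> 2 ^ m0 * D" by (simp add: field_simps)
      then have "1 \<le> (2 ^ m0 * D) powr \<gamma>" using \<gamma> by (simp add: ge_one_powr_ge_zero)
      then have one: "1 \<le> (2 ^ m0) powr \<gamma> * D powr \<gamma>"
        using D by (simp add: powr_mult)
      have "dist (h x) (h y) \<le> 2 * b"
        using b(2)[OF xy(1)] b(2)[OF xy(2)] norm_triangle_ineq4[of "h x" "h y"] by (simp add: dist_norm)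
      also have "\<dots> \<le> 2 * b * ((2 ^ m0) powr \<gamma> * D powr \<gamma>)"
        using one b by (simp add: mult_left_mono)
      also have "\<dots> \<le> A * D powr \<gamma>"
        unfolding mult.assoc[symmetric] by (intro mult_right_mono A) simp
      finally show ?thesis by (simp add: D_def)
    qed
  qed simp
  then show ?thesis using A by auto
qed

text \<open>There are O(2^(mN)) dyadic increments on level m, and each exceeds 2^(-\<gamma>m) with
  probability O(2^(-2k(H-\<gamma>)m)) by the moment of order 2k. For large k the union bound is
  summable, so Borel-Cantelli supplies the hypothesis of the chaining lemma.\<close>

lemma AE_fbm_Hoelder:
  fixes X :: "real ^ 'n \<Rightarrow> 'w \<Rightarrow> real ^ 'd"
  assumes H: "0 < H" and X: "fractional_brownian_motion H M X" and \<gamma>: "0 < \<gamma>" "\<gamma> < H"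
  shows "AE \<omega> in M. \<forall>R. \<exists>A>0. \<forall>x\<in>cball 0 R. \<forall>y\<in>cball 0 R. dist (X x \<omega>) (X y \<omega>) \<le> A * dist x y powr \<gamma>"
proof -
  interpret prob_space M
    using X by (simp add: fractional_brownian_motion_def)
  note [measurable] = fbm_measurable[OF H X]
  let ?N = "CARD('n)" and ?d = "CARD('d)"
  define \<theta> where "\<theta> = 2 powr (- \<gamma>)"
  have \<theta>: "0 < \<theta>" by (simp add: \<theta>_def)
  \<comment> \<open>The moment order is chosen so that 2k(H - \<gamma>) exceeds N, which makes the
    ratio \<open>a\<close> below less than 1.\<close>
  obtain k :: nat where "real ?N / (2 * (H - \<gamma>)) < real k"
    using reals_Archimedean2 by blast
  then have k: "real ?N < 2 * real k * (H - \<gamma>)"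
    using \<gamma> by (simp add: field_simps)
  define a where "a = 2 powr (real ?N - 2 * real k * (H - \<gamma>))"
  have a: "0 < a" "a < 1" using k by (auto simp: a_def powr_less_one)
  have cont: "AE \<omega> in M. continuous_on UNIV (\<lambda>t. X t \<omega>)"
    using X by (simp add: fractional_brownian_motion_def)
  have Hoelder_R: "AE \<omega> in M. \<exists>A>0. \<forall>x\<in>cball 0 (real R). \<forall>y\<in>cball 0 (real R).
      dist (X x \<omega>) (X y \<omega>) \<le> A * dist x y powr \<gamma>" for R :: nat
  proof -
    define I where "I m = (dyadic_box R m \<times> dyadic_steps \<times> UNIV :: (('n \<Rightarrow> int) \<times> ('n \<Rightarrow> int) \<times> 'd) set)" for m
    define S where "S m i = (case i of (z, e, j) \<Rightarrow>
      {\<omega> \<in> space M. \<theta> ^ m \<le> \<bar>X (dyadic_point m z) \<omega> $ j - X (dyadic_point m (\<lambda>i. z i + e i)) \<omega> $ j\<bar>})"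
      for m and i :: "('n \<Rightarrow> int) \<times> ('n \<Rightarrow> int) \<times> 'd"
    define bad where "bad m = (\<Union>i\<in>I m. S m i)" for m
    have fin: "finite (I m)" for m
      unfolding I_def by (intro finite_cartesian_product finite_dyadic_box finite_dyadic_steps) simp
    have meas: "S m i \<in> sets M" for m i
      unfolding S_def by (cases i) simp
    define c where "c = fact (2 * k) / (2 ^ k * fact k) * (real ?N powr H) ^ (2 * k)"
    define C where "C = real (2 * R + 3) ^ ?N * 3 ^ ?N * real ?d * c"
    have "0 \<le> c" by (simp add: c_def)
    have bound: "prob (bad m) \<le> C * a ^ m" for m
    proof -
      have S_le: "prob (S m i) \<le> c * (2 powr (- 2 * real k * (H - \<gamma>))) ^ m" if iI: "i \<in> I m" for i
      proof -
        obtain z e j where i: "i = (z, e, j)" and e: "e \<in> dyadic_steps"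
          using iI by (auto simp: I_def)
        let ?D = "norm (dyadic_point m z - dyadic_point m (\<lambda>i. z i + e i))"
        have "prob (S m i) \<le> fact (2 * k) / (2 ^ k * fact k) * (?D powr H / \<theta> ^ m) ^ (2 * k)"
          unfolding S_def i prod.case using \<theta> by (intro fbm_component_tail[OF H X]) simp
        also have "\<dots> \<le> fact (2 * k) / (2 ^ k * fact k) * ((real ?N / 2 ^ m) powr H / \<theta> ^ m) ^ (2 * k)"
          using norm_dyadic_step_le[OF e, of m z] H \<theta>
          by (intro mult_left_mono power_mono divide_right_mono powr_mono2) auto
        also have "(real ?N / 2 ^ m) powr H / \<theta> ^ m = real ?N powr H * 2 powr (- (real m * (H - \<gamma>)))"
        proof -
          have "(real ?N / 2 ^ m) powr H = real ?N powr H / 2 powr (real m * H)"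
            by (simp add: powr_divide powr_realpow[symmetric] powr_powr)
          moreover have "\<theta> ^ m = 2 powr (- (real m * \<gamma>))"
            by (simp add: \<theta>_def powr_realpow[symmetric] powr_powr mult_ac)
          moreover have "2 powr (- (real m * (H - \<gamma>))) = 1 / 2 powr (real m * H) / 2 powr (- (real m * \<gamma>))"
            unfolding powr_minus_divide[symmetric] powr_diff[symmetric] by (simp add: algebra_simps)
          ultimately show ?thesis by simp
        qed
        also have "(real ?N powr H * 2 powr (- (real m * (H - \<gamma>)))) ^ (2 * k) =
            (real ?N powr H) ^ (2 * k) * (2 powr (- 2 * real k * (H - \<gamma>))) ^ m"
        proof -
          have "(2 powr (- (real m * (H - \<gamma>)))) ^ (2 * k) = 2 powr (- (real m * (H - \<gamma>)) * real (2 * k))"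
            by (simp add: powr_power mult_ac)
          also have "\<dots> = 2 powr ((- 2 * real k * (H - \<gamma>)) * real m)"
            by (simp add: algebra_simps)
          also have "\<dots> = (2 powr (- 2 * real k * (H - \<gamma>))) ^ m"
            by (simp add: powr_power mult_ac)
          finally show ?thesis by (simp only: power_mult_distrib)
        qed
        finally show ?thesis by (simp add: c_def mult_ac)
      qed
      have "prob (bad m) \<le> (\<Sum>i\<in>I m. prob (S m i))"
        unfolding bad_def using fin meas by (intro finite_measure_subadditive_finite) auto
      also have "\<dots> \<le> (\<Sum>i\<in>I m. c * (2 powr (- 2 * real k * (H - \<gamma>))) ^ m)"
        by (intro sum_mono S_le)
      also have "\<dots> = real (card (I m)) * (c * (2 powr (- 2 * real k * (H - \<gamma>))) ^ m)"
        by simp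
      also have "\<dots> \<le> ((real (2 * R + 3) * 2 ^ m) ^ ?N * 3 ^ ?N * real ?d) * (c * (2 powr (- 2 * real k * (H - \<gamma>))) ^ m)"
      proof (intro mult_right_mono)
        show "real (card (I m)) \<le> (real (2 * R + 3) * 2 ^ m) ^ ?N * 3 ^ ?N * real ?d"
          using card_dyadic_box[where R = R and m = m and 'n = 'n]
          by (simp add: I_def card_cartesian_product card_dyadic_steps mult_ac)
      qed (use \<open>0 \<le> c\<close> in simp)
      also have "\<dots> = C * ((2 ^ m) ^ ?N * (2 powr (- 2 * real k * (H - \<gamma>))) ^ m)"
        by (simp only: C_def power_mult_distrib mult_ac)
      also have "(2 ^ m) ^ ?N * (2 powr (- 2 * real k * (H - \<gamma>))) ^ m = a ^ m"
      proof -
        have p: "((2::real) ^ m) ^ ?N = (2 powr real ?N) ^ m"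
        proof -
          have "(2 powr real ?N :: real) = 2 ^ ?N" by (rule powr_realpow) simp
          then show ?thesis by (simp only: power_mult[symmetric] mult.commute)
        qed
        have a: "a = 2 powr real ?N * 2 powr (- 2 * real k * (H - \<gamma>))"
          unfolding a_def powr_add[symmetric] by simp
        have "((2::real) ^ m) ^ ?N * (2 powr (- 2 * real k * (H - \<gamma>))) ^ m =
            (2 powr real ?N) ^ m * (2 powr (- 2 * real k * (H - \<gamma>))) ^ m"
          unfolding p ..
        also have "\<dots> = a ^ m" unfolding a power_mult_distrib ..
        finally show ?thesis .
      qed
      finally show ?thesis .
    qed
    have "AE \<omega> in M. eventually (\<lambda>m. \<omega> \<in> space M - bad m) sequentially"
    proof (rule borel_cantelli_AE1)
      show "bad m \<in> sets M" for m
        unfolding bad_def using fin meas by (intro sets.finite_UN) auto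
      show "summable (\<lambda>m. prob (bad m))"
      proof (rule summable_comparison_test')
        show "summable (\<lambda>m. C * a ^ m)"
          using a by (intro summable_mult summable_geometric) simp
        show "norm (prob (bad m)) \<le> C * a ^ m" for m
          using bound[of m] by simp
      qed
    qed (simp add: emeasure_eq_measure)
    then show ?thesis
      using cont
    proof eventually_elim
      case (elim \<omega>)
      show ?case
      proof (rule Hoelder_of_dyadic_increments[OF elim(2) \<gamma>(1)])
        from elim(1) show "\<forall>\<^sub>F m in sequentially. \<forall>z\<in>dyadic_box R m. \<forall>e\<in>dyadic_steps. \<forall>j.
            \<bar>X (dyadic_point m z) \<omega> $ j - X (dyadic_point m (\<lambda>i. z i + e i)) \<omega> $ j\<bar> \<le> (2 powr (- \<gamma>)) ^ m"
        proof eventually_elim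
          case (elim m)
          have "\<omega> \<notin> S m (z, e, j)" if "z \<in> dyadic_box R m" "e \<in> dyadic_steps" for z e j
            using elim that by (auto simp: bad_def I_def)
          then show ?case
            using elim unfolding S_def \<theta>_def by (intro ballI allI) (auto simp: not_le intro: less_imp_le)
        qed
      qed
    qed
  qed
  then have "AE \<omega> in M. \<forall>R::nat. \<exists>A>0. \<forall>x\<in>cball 0 (real R). \<forall>y\<in>cball 0 (real R).
      dist (X x \<omega>) (X y \<omega>) \<le> A * dist x y powr \<gamma>"
    by (simp add: AE_all_countable)
  then show ?thesis
  proof eventually_elim
    case (elim \<omega>)
    show ?case
    proof
      fix R
      obtain R' :: nat where "R \<le> real R'" using real_arch_simple by blast
      then have "cball 0 R \<subseteq> cball 0 (real R')" by auto
      then show "\<exists>A>0. \<forall>x\<in>cball 0 R. \<forall>y\<in>cball 0 R. dist (X x \<omega>) (X y \<omega>) \<le> A * dist x y powr \<gamma>"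
        using elim by (meson subsetD)
    qed
  qed
qed

section \<open>Dimension of the image of a fixed set\<close>

text \<open>Assign every point to a center of a maximal separated set. The masses collected at the
  centers have total equal to the sum of the weights, so the Cauchy-Schwarz inequality bounds its
  square by the number of centers times the sum of squared masses; points sharing a center are
  within 4r.\<close>

lemma power2_sum_le_packing_number_energy:
  fixes y :: "nat \<Rightarrow> 'a::euclidean_space"
  assumes "bounded G" "0 < r" and y: "\<And>i. i < n \<Longrightarrow> y i \<in> G" and w: "\<And>i. i < n \<Longrightarrow> 0 \<le> w i"
  shows "(\<Sum>i<n. w i)\<^sup>2 \<le> real (packing_number r G) *
    (\<Sum>i<n. \<Sum>j<n. w i * w j * of_bool (dist (y i) (y j) \<le> 4 * r))"
proof -
  let ?sep = "pairwise (\<lambda>x y. 2 * r < dist x y)"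
  let ?\<C> = "{C. C \<subseteq> y ` {..<n} \<and> ?sep C}"
  have "finite ?\<C>" by (rule finite_subset[of _ "Pow (y ` {..<n})"]) auto
  moreover have "?\<C> \<noteq> {}" by (auto intro: exI[of _ "{}"])
  ultimately have "\<exists>C\<in>?\<C>. \<forall>D\<in>?\<C>. C \<le> D \<longrightarrow> C = D"
    by (rule finite_has_maximal)
  then obtain C where C: "C \<in> ?\<C>" and max: "\<forall>D\<in>?\<C>. C \<le> D \<longrightarrow> C = D"
    by (elim bexE)
  have finC: "finite C" using C finite_subset by blast
  \<comment> \<open>A point farther than 2r from all centers could be added to \<open>C\<close>,
    against maximality.\<close>
  have "\<exists>c\<in>C. dist (y i) c \<le> 2 * r" if "i < n" for i
  proof (rule ccontr)
    assume "\<not> ?thesis"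
    then have far: "\<And>c. c \<in> C \<Longrightarrow> 2 * r < dist (y i) c" by force
    then have "insert (y i) C \<in> ?\<C>"
      using C that by (auto simp: pairwise_insert dist_commute)
    then have "y i \<in> C" using max by blast
    with far[of "y i"] \<open>0 < r\<close> show False by simp
  qed
  then obtain c where c: "\<And>i. i < n \<Longrightarrow> c i \<in> C" "\<And>i. i < n \<Longrightarrow> dist (y i) (c i) \<le> 2 * r"
    by metis
  have close: "dist (y i) (y j) \<le> 4 * r" if "i < n" "j < n" "c i = c j" for i j
    using c(2)[OF that(1)] c(2)[OF that(2)] that(3) dist_triangle2[of "y i" "y j" "c i"] by simp
  define m where "m a = (\<Sum>i<n. w i * of_bool (c i = a))" for a
  have "(\<Sum>a\<in>C. m a) = (\<Sum>i<n. \<Sum>a\<in>C. w i * of_bool (c i = a))"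
    unfolding m_def by (rule sum.swap)
  also have "\<dots> = (\<Sum>i<n. w i)"
  proof (intro sum.cong refl)
    fix i assume "i \<in> {..<n}"
    have "(\<Sum>a\<in>C. w i * of_bool (c i = a)) = (\<Sum>a\<in>C. if c i = a then w i else 0)"
      by (intro sum.cong) auto
    then show "(\<Sum>a\<in>C. w i * of_bool (c i = a)) = w i"
      using c(1) finC \<open>i \<in> {..<n}\<close> by simp
  qed
  finally have "(\<Sum>i<n. w i)\<^sup>2 = (\<Sum>a\<in>C. m a)\<^sup>2" by simp
  also have "\<dots> \<le> real (card C) * (\<Sum>a\<in>C. (m a)\<^sup>2)"
    using sum_squared_le_sum_of_squares[of m C] by (simp add: mult_ac)
  also have "(\<Sum>a\<in>C. (m a)\<^sup>2) =
      (\<Sum>a\<in>C. \<Sum>i<n. \<Sum>j<n. w i * w j * (of_bool (c i = a) * of_bool (c j = a)))"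
    unfolding m_def power2_eq_square sum_product by (intro sum.cong refl) (simp only: mult_ac)
  also have "\<dots> = (\<Sum>i<n. \<Sum>j<n. \<Sum>a\<in>C. w i * w j * (of_bool (c i = a) * of_bool (c j = a)))"
    by (subst sum.swap) (intro sum.cong refl sum.swap)
  also have "\<dots> \<le> (\<Sum>i<n. \<Sum>j<n. w i * w j * of_bool (dist (y i) (y j) \<le> 4 * r))"
  proof (intro sum_mono)
    fix i j assume ij: "i \<in> {..<n}" "j \<in> {..<n}"
    have "(\<Sum>a\<in>C. w i * w j * (of_bool (c i = a) * of_bool (c j = a)))
        = (\<Sum>a\<in>C. if c i = a then w i * w j * of_bool (c j = c i) else 0)"
      by (intro sum.cong) auto
    also have "\<dots> = w i * w j * of_bool (c j = c i)"
      using c(1) ij finC by simp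
    also have "\<dots> \<le> w i * w j * of_bool (dist (y i) (y j) \<le> 4 * r)"
      using close[of i j] w ij by (intro mult_left_mono) auto
    finally show "(\<Sum>a\<in>C. w i * w j * (of_bool (c i = a) * of_bool (c j = a)))
      \<le> w i * w j * of_bool (dist (y i) (y j) \<le> 4 * r)" .
  qed
  also have "real (card C) * \<dots> \<le> real (packing_number r G) * \<dots>"
  proof (intro mult_right_mono sum_nonneg)
    show "real (card C) \<le> real (packing_number r G)"
      using C finC y by (auto intro!: card_le_packing_number assms)
  qed (use w in auto)
  finally show ?thesis by (simp add: mult_left_mono)
qed

text \<open>Used to replace all radii of one dyadic class by a common radius at the cost of the
  factor 2^s.\<close>

lemma howroyd_kernel_scale_le:
  assumes "0 \<le> s" "0 < a" "0 < b" "a \<le> 2 * b"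
  shows "howroyd_kernel s (b *\<^sub>R v) \<le> 2 powr s * howroyd_kernel s (a *\<^sub>R v)"
proof (cases "v = 0")
  case True
  then show ?thesis using assms by (simp add: howroyd_kernel_def ge_one_powr_ge_zero)
next
  case False
  have one: "1 \<le> 2 powr s" using assms by (simp add: ge_one_powr_ge_zero)
  have "(b * norm v) powr (- s) \<le> (a * norm v / 2) powr (- s)"
    using assms False by (intro powr_mono2') (auto simp: mult_right_mono)
  also have "\<dots> = 2 powr s * (a * norm v) powr (- s)"
    using assms False by (simp add: powr_divide powr_minus_divide)
  finally have "(b * norm v) powr (- s) \<le> 2 powr s * (a * norm v) powr (- s)" .
  then have "min 1 ((b * norm v) powr (- s)) \<le> 2 powr s * min 1 ((a * norm v) powr (- s))"
    using one by (simp add: min_def)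
  then show ?thesis
    using assms False by (simp add: howroyd_kernel_def)
qed

lemma sum_power_le_tail:
  fixes a :: real
  assumes "0 < a" "a < 1" "finite S" "\<And>m. m \<in> S \<Longrightarrow> m1 \<le> m"
  shows "(\<Sum>m\<in>S. a ^ m) \<le> a ^ m1 / (1 - a)"
proof -
  have "(\<Sum>m\<in>S. a ^ m) = (\<Sum>m\<in>S. a ^ m1 * a ^ (m - m1))"
    using assms by (intro sum.cong) (auto simp flip: power_add)
  also have "\<dots> = (\<Sum>j\<in>(\<lambda>m. m - m1) ` S. a ^ m1 * a ^ j)"
    using assms(4) by (subst sum.reindex) (auto intro!: inj_onI dest: eq_diff_iff)
  also have "\<dots> \<le> (\<Sum>j. a ^ m1 * a ^ j)"
    using assms by (intro sum_le_suminf summable_mult summable_geometric) auto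
  also have "\<dots> = a ^ m1 / (1 - a)"
    using assms by (simp add: suminf_mult suminf_geometric summable_geometric)
  finally show ?thesis .
qed

text \<open>Suppose that admissible weights at each scale m >= m0 have mass at most 2^(bm). Sorting
  the radii of a fine packing into dyadic classes bounds its total by a tail of a geometric series
  of ratio 2^(b-\<alpha>). This tends to 0 with the radii, against the positive premeasure.\<close>

lemma dyadic_weights_of_howroyd_premeasure:
  fixes F :: "'a::euclidean_space set"
  assumes pos: "howroyd_premeasure \<alpha> s F \<noteq> 0" and "0 \<le> s" "0 < \<alpha>" "b < \<alpha>"
  shows "\<exists>m\<ge>m0. \<exists>(n :: nat) w x. (\<forall>i<n. 0 \<le> w i \<and> x i \<in> F) \<and>
    (\<forall>i<n. (\<Sum>j<n. w j * howroyd_kernel s (2 ^ m *\<^sub>R (x i - x j))) \<le> 2 powr s) \<and>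
    2 powr (b * real m) < (\<Sum>i<n. w i)"
proof -
  define good where "good m n w x \<longleftrightarrow> (\<forall>i<n. 0 \<le> w i \<and> x i \<in> F) \<and>
    (\<forall>i<n. (\<Sum>j<n. w j * howroyd_kernel s (2 ^ m *\<^sub>R (x i - x j))) \<le> 2 powr s) \<and>
    2 powr (b * real m) < (\<Sum>i<n. w i)" for m n :: nat and w :: "nat \<Rightarrow> real" and x :: "nat \<Rightarrow> 'a"
  have "\<exists>m\<ge>m0. \<exists>n w x. good m n w x"
  proof (rule ccontr)
    assume no: "\<not> (\<exists>m\<ge>m0. \<exists>n w x. good m n w x)"
    have small: "(\<Sum>i<n. w i) \<le> 2 powr (b * real m)"
      if "m \<ge> m0" "\<And>i. i < n \<Longrightarrow> 0 \<le> w i" "\<And>i. i < n \<Longrightarrow> x i \<in> F"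
        "\<And>i. i < n \<Longrightarrow> (\<Sum>j<n. w j * howroyd_kernel s (2 ^ m *\<^sub>R (x i - x j))) \<le> 2 powr s"
      for m n and w :: "nat \<Rightarrow> real" and x
    proof (rule ccontr)
      assume "\<not> (\<Sum>i<n. w i) \<le> 2 powr (b * real m)"
      then have "good m n w x"
        unfolding good_def using that by simp
      with no that(1) show False by blast
    qed
    define a where "a = 2 powr (b - \<alpha>)"
    have a: "0 < a" "a < 1" using \<open>b < \<alpha>\<close> by (auto simp: a_def powr_less_one)
    \<comment> \<open>The premeasure may be infinite, so a finite positive number below it is
      used.\<close>
    obtain c where c: "0 < c" "ennreal c < howroyd_premeasure \<alpha> s F"
    proof -
      obtain z where z: "0 < z" "z < howroyd_premeasure \<alpha> s F"
        using pos dense[of 0 "howroyd_premeasure \<alpha> s F"] by (auto simp: zero_less_iff_neq_zero)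
      then have "z < top" using less_top order_less_le_trans top_greatest by blast
      then show ?thesis using that[of "enn2real z"] z by (simp add: enn2real_positive_iff)
    qed
    have "(\<lambda>m. 2 powr \<alpha> * (a ^ m / (1 - a))) \<longlonglongrightarrow> 2 powr \<alpha> * (0 / (1 - a))"
      using a by (intro tendsto_intros LIMSEQ_realpow_zero) auto
    then have "eventually (\<lambda>m. 2 powr \<alpha> * (a ^ m / (1 - a)) < c) sequentially"
      using c by (intro order_tendstoD) auto
    then have "eventually (\<lambda>m. m \<ge> m0 \<and> 2 powr \<alpha> * (a ^ m / (1 - a)) < c) sequentially"
      using eventually_ge_at_top[of m0] by eventually_elim simp
    then obtain m1 where m1: "m1 \<ge> m0" "2 powr \<alpha> * (a ^ m1 / (1 - a)) < c"
      by (auto simp: eventually_sequentially)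
    have "howroyd_premeasure \<alpha> s F \<le> howroyd_sup \<alpha> s (1 / 2 ^ m1) F"
      unfolding howroyd_premeasure_eq_INF by (intro INF_lower) simp
    with c have "ennreal c < howroyd_sup \<alpha> s (1 / 2 ^ m1) F" by simp
    then obtain w x r where pack: "howroyd_packing s (1 / 2 ^ m1) F w x r"
      and "ennreal c < (\<Sum>i. ennreal (w i * (2 * r i) powr \<alpha>))"
      unfolding howroyd_sup_def less_Sup_iff by blast
    \<comment> \<open>Truncation to finitely many terms keeps the total above \<open>c\<close> and
      turns all sums into real ones.\<close>
    then obtain n where n: "ennreal c < (\<Sum>i<n. ennreal (w i * (2 * r i) powr \<alpha>))"
      unfolding suminf_eq_SUP less_SUP_iff by blast
    have w: "0 \<le> w i" and x: "x i \<in> F" and r: "0 < r i" "r i \<le> 1 / 2 ^ m1" for i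
      using pack by (auto simp: howroyd_packing_def)
    have "c < (\<Sum>i<n. w i * (2 * r i) powr \<alpha>)"
      using n w c by (simp add: sum_ennreal ennreal_less_iff)
    have row: "(\<Sum>j<n. w j * howroyd_kernel s ((1 / r j) *\<^sub>R (x i - x j))) \<le> 1" for i
    proof -
      have "ennreal (\<Sum>j<n. w j * howroyd_kernel s ((1 / r j) *\<^sub>R (x i - x j)))
          = (\<Sum>j<n. ennreal (w j * howroyd_kernel s ((1 / r j) *\<^sub>R (x i - x j))))"
        using w by (intro sum_ennreal[symmetric]) (auto simp: howroyd_kernel_nonneg)
      also have "\<dots> \<le> (\<Sum>j. ennreal (w j * howroyd_kernel s ((1 / r j) *\<^sub>R (x i - x j))))"
        by (rule sum_le_suminf) auto
      also have "\<dots> \<le> 1"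
        using pack unfolding howroyd_packing_def SUP_le_iff by blast
      finally show ?thesis by (simp add: ennreal_le_1)
    qed
    \<comment> \<open>The dyadic class of the radius: \<open>r i\<close> lies between 2^(-k-1) and
      2^(-k).\<close>
    define k where "k i = nat \<lfloor>log 2 (1 / r i)\<rfloor>" for i
    have k: "m1 \<le> k i" "2 ^ k i \<le> 1 / r i" "1 / r i \<le> 2 * 2 ^ k i" for i
    proof -
      have "2 ^ m1 \<le> 1 / r i" using r[of i] by (simp add: field_simps)
      have rp: "0 < 1 / r i" using r[of i] by simp
      with \<open>2 ^ m1 \<le> 1 / r i\<close> have l: "real m1 \<le> log 2 (1 / r i)"
        using r[of i] by (simp add: le_log_iff powr_realpow)
      then show "m1 \<le> k i" by (simp add: k_def le_nat_floor)
      have "real (k i) \<le> log 2 (1 / r i)" "log 2 (1 / r i) \<le> real (Suc (k i))"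
        unfolding k_def using l by linarith+
      then have "2 powr real (k i) \<le> 1 / r i" "1 / r i \<le> 2 powr real (Suc (k i))"
        using le_log_iff[OF _ rp, of 2] log_le_iff[OF _ rp, of 2] by simp_all
      then show "2 ^ k i \<le> 1 / r i" "1 / r i \<le> 2 * 2 ^ k i"
        unfolding powr_realpow[OF zero_less_numeral] by simp_all
    qed
    \<comment> \<open>All points are kept and the weights outside class \<open>m\<close> are set to
      0; the kernel comparison turns the row bound 1 into 2^s.\<close>
    have group: "(\<Sum>i<n. w i * of_bool (k i = m)) \<le> 2 powr (b * real m)" if "m \<ge> m1" for m
    proof (rule small)
      fix i assume "i < n"
      have "(\<Sum>j<n. w j * of_bool (k j = m) * howroyd_kernel s (2 ^ m *\<^sub>R (x i - x j)))
          \<le> (\<Sum>j<n. 2 powr s * (w j * howroyd_kernel s ((1 / r j) *\<^sub>R (x i - x j))))"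
      proof (rule sum_mono)
        fix j
        show "w j * of_bool (k j = m) * howroyd_kernel s (2 ^ m *\<^sub>R (x i - x j))
            \<le> 2 powr s * (w j * howroyd_kernel s ((1 / r j) *\<^sub>R (x i - x j)))"
        proof (cases "k j = m")
          case True
          have "howroyd_kernel s (2 ^ m *\<^sub>R (x i - x j)) \<le> 2 powr s * howroyd_kernel s ((1 / r j) *\<^sub>R (x i - x j))"
            using k[of j] r[of j] True \<open>0 \<le> s\<close> by (intro howroyd_kernel_scale_le) auto
          from mult_left_mono[OF this w[of j]] show ?thesis
            using True by (simp add: mult.left_commute)
        qed (use w in \<open>simp add: howroyd_kernel_nonneg\<close>)
      qed
      also have "\<dots> \<le> 2 powr s"
        unfolding sum_distrib_left[symmetric] using row[of i] by (simp add: mult_left_le)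
      finally show "(\<Sum>j<n. w j * of_bool (k j = m) * howroyd_kernel s (2 ^ m *\<^sub>R (x i - x j))) \<le> 2 powr s" .
    qed (use that m1 w x in auto)
    have "(\<Sum>i<n. w i * (2 * r i) powr \<alpha>) \<le> (\<Sum>i<n. w i * (2 powr \<alpha> * 2 powr (- (\<alpha> * real (k i)))))"
    proof (intro sum_mono mult_left_mono w)
      fix i
      have "2 * r i \<le> 2 * 2 powr (- real (k i))"
        using k(2)[of i] r[of i] by (simp add: powr_minus powr_realpow field_simps)
      then have "(2 * r i) powr \<alpha> \<le> (2 * 2 powr (- real (k i))) powr \<alpha>"
        using r[of i] \<open>0 < \<alpha>\<close> by (intro powr_mono2) auto
      also have "\<dots> = 2 powr \<alpha> * 2 powr (- (\<alpha> * real (k i)))"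
        by (simp add: powr_mult powr_powr mult_ac)
      finally show "(2 * r i) powr \<alpha> \<le> 2 powr \<alpha> * 2 powr (- (\<alpha> * real (k i)))" .
    qed
    also have "\<dots> = (\<Sum>i<n. \<Sum>m\<in>k ` {..<n}. w i * of_bool (k i = m) * (2 powr \<alpha> * 2 powr (- (\<alpha> * real m))))"
    proof (intro sum.cong refl)
      fix i assume "i \<in> {..<n}"
      then have "w i * (2 powr \<alpha> * 2 powr (- (\<alpha> * real (k i)))) =
        (\<Sum>m\<in>k ` {..<n}. if k i = m then w i * (2 powr \<alpha> * 2 powr (- (\<alpha> * real m))) else 0)"
        by simp
      also have "\<dots> = (\<Sum>m\<in>k ` {..<n}. w i * of_bool (k i = m) * (2 powr \<alpha> * 2 powr (- (\<alpha> * real m))))"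
        by (intro sum.cong) auto
      finally show "w i * (2 powr \<alpha> * 2 powr (- (\<alpha> * real (k i)))) =
        (\<Sum>m\<in>k ` {..<n}. w i * of_bool (k i = m) * (2 powr \<alpha> * 2 powr (- (\<alpha> * real m))))" .
    qed
    also have "\<dots> = (\<Sum>m\<in>k ` {..<n}. (\<Sum>i<n. w i * of_bool (k i = m)) * (2 powr \<alpha> * 2 powr (- (\<alpha> * real m))))"
      unfolding sum_distrib_right by (rule sum.swap)
    also have "\<dots> \<le> (\<Sum>m\<in>k ` {..<n}. 2 powr (b * real m) * (2 powr \<alpha> * 2 powr (- (\<alpha> * real m))))"
      using k(1) by (intro sum_mono mult_right_mono group) auto
    also have "\<dots> = 2 powr \<alpha> * (\<Sum>m\<in>k ` {..<n}. a ^ m)"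
      unfolding sum_distrib_left
    proof (intro sum.cong refl)
      fix m
      have "a ^ m = 2 powr (b * real m) * 2 powr (- (\<alpha> * real m))"
        by (simp add: a_def powr_power powr_add[symmetric] algebra_simps)
      then show "2 powr (b * real m) * (2 powr \<alpha> * 2 powr (- (\<alpha> * real m))) = 2 powr \<alpha> * a ^ m"
        by simp
    qed
    also have "\<dots> \<le> 2 powr \<alpha> * (a ^ m1 / (1 - a))"
      using a k(1) by (intro mult_left_mono sum_power_le_tail) auto
    finally show False
      using m1 \<open>c < _\<close> by simp
  qed
  then show ?thesis unfolding good_def .
qed

section \<open>Energy estimates for the image of a fixed set\<close>

lemma upper_box_dim_ge:
  fixes G :: "'a::euclidean_space set"
  assumes r: "filterlim r (at_right 0) sequentially"
    and ev: "eventually (\<lambda>k. t * ln (1 / r k) \<le> ln (real (packing_number (r k) G))) sequentially"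
  shows "ereal t \<le> upper_box_dim G"
proof (rule ccontr)
  assume "\<not> ?thesis"
  then have "Limsup (at_right 0) (\<lambda>r. ereal (ln (real (packing_number r G)) / ln (1 / r))) < ereal t"
    by (simp add: upper_box_dim_def)
  then have "eventually (\<lambda>r. ereal (ln (real (packing_number r G)) / ln (1 / r)) < ereal t) (at_right 0)"
    by (rule Limsup_lessD)
  then have "eventually (\<lambda>r. ln (real (packing_number r G)) < t * ln (1 / r)) (at_right 0)"
    using eventually_at_right_0_less[of 1, OF zero_less_one]
  proof eventually_elim
    case (elim r)
    then have "0 < ln (1 / r)" by simp
    then show ?case using elim(1) by (simp add: divide_less_eq)
  qed
  then have "eventually (\<lambda>k. ln (real (packing_number (r k) G)) < t * ln (1 / r k)) sequentially"
    using r by (rule eventually_compose_filterlim)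
  with ev have "eventually (\<lambda>k. False) sequentially"
    by eventually_elim simp
  then show False by simp
qed

text \<open>Here the profile index s = Hd arises: the small ball bound at radius 4 * 2^(-Hm) is a
  constant times |2^m (u - t)|^(-Hd). The truncation of the kernel at 1 is harmless because a
  probability is at most 1 and the constant is at least 1.\<close>

lemma fbm_small_ball_le_kernel:
  fixes X :: "real ^ 'n \<Rightarrow> 'w \<Rightarrow> real ^ 'd"
  assumes H: "0 < H" and X: "fractional_brownian_motion H M X"
  shows "measure M {\<omega> \<in> space M. dist (X u \<omega>) (X t \<omega>) \<le> 4 * 2 powr (- (H * real m))}
    \<le> exp (1 / 2) * 4 ^ CARD('d) * howroyd_kernel (H * real CARD('d)) (2 ^ m *\<^sub>R (u - t))"
    (is "?p \<le> ?C * _")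
proof -
  interpret prob_space M
    using X by (simp add: fractional_brownian_motion_def)
  have C: "1 \<le> ?C"
    using mult_mono[of 1 "exp (1 / 2)" 1 "4 ^ CARD('d) :: real"] by simp
  have p1: "?p \<le> ?C" using prob_le_1 C by (rule order_trans)
  show ?thesis
  proof (cases "u = t")
    case True
    then show ?thesis using p1 by (simp add: howroyd_kernel_def)
  next
    case False
    have "?p \<le> exp (1 / 2) * ((4 * 2 powr (- (H * real m))) / norm (u - t) powr H) ^ CARD('d)"
      by (rule fbm_small_ball[OF H X False]) simp
    also have "(4 * 2 powr (- (H * real m))) / norm (u - t) powr H = 4 * (norm (2 ^ m *\<^sub>R (u - t))) powr (- H)"
    proof -
      have "(norm (2 ^ m *\<^sub>R (u - t))) powr (- H) = (2 ^ m) powr (- H) * norm (u - t) powr (- H)"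
        using False by (simp add: powr_mult)
      also have "((2::real) ^ m) powr (- H) = 2 powr (- (H * real m))"
        by (simp add: powr_realpow[symmetric] powr_powr mult_ac)
      finally show ?thesis by (simp add: powr_minus divide_inverse)
    qed
    also have "(4 * (norm (2 ^ m *\<^sub>R (u - t))) powr (- H)) ^ CARD('d)
        = 4 ^ CARD('d) * (norm (2 ^ m *\<^sub>R (u - t))) powr (- (H * real CARD('d)))"
      using False by (simp add: power_mult_distrib powr_power mult_ac)
    finally have "?p \<le> ?C * (norm (2 ^ m *\<^sub>R (u - t))) powr (- (H * real CARD('d)))"
      by (simp only: mult.assoc)
    with p1 show ?thesis
      using False unfolding howroyd_kernel_def by (auto simp: min_def)
  qed
qed

text \<open>The exceptional null set is determined by countably many points of \<open>F\<close>
  chosen in advance and does not depend on \<open>G\<close>; the later argument needs this because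
  its sets \<open>G\<close> vary with \<omega>. Weights of mass W' at scale m have mean energy at
  most C W', so by Borel-Cantelli the energy is eventually below 2^(\<epsilon>m) W', and the packing
  number exceeds W' 2^(-\<epsilon>m), hence 2^(bm).\<close>

lemma AE_fbm_upper_box_dim_ge:
  fixes X :: "real ^ 'n \<Rightarrow> 'w \<Rightarrow> real ^ 'd"
  assumes H: "0 < H" and X: "fractional_brownian_motion H M X"
    and pos: "howroyd_premeasure \<alpha> (H * real CARD('d)) F \<noteq> 0" and b: "0 < b" "b < \<alpha>"
  shows "AE \<omega> in M. \<forall>G. bounded G \<longrightarrow> (\<lambda>t. X t \<omega>) ` F \<subseteq> G \<longrightarrow> ereal (b / H) \<le> upper_box_dim G"
proof -
  interpret prob_space M
    using X by (simp add: fractional_brownian_motion_def)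
  note [measurable] = fbm_measurable[OF H X]
  define s where "s = H * real CARD('d)"
  have s: "0 \<le> s" using H by (simp add: s_def)
  \<comment> \<open>Half of the gap: the weights are taken with mass exponent b + \<epsilon>, and
    \<epsilon> is spent in Markov's inequality.\<close>
  define \<epsilon> where "\<epsilon> = (\<alpha> - b) / 2"
  have \<epsilon>: "0 < \<epsilon>" "b + \<epsilon> < \<alpha>" using b by (auto simp: \<epsilon>_def field_simps)
  have "\<forall>k. \<exists>m n w x. k \<le> m \<and> (\<forall>i<n. 0 \<le> w i \<and> x i \<in> F) \<and>
    (\<forall>i<n. (\<Sum>j<n. w j * howroyd_kernel s (2 ^ m *\<^sub>R (x i - x j))) \<le> 2 powr s) \<and>
    2 powr ((b + \<epsilon>) * real m) < (\<Sum>i<n::nat. w i)"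
  proof
    fix k
    from dyadic_weights_of_howroyd_premeasure[OF pos[folded s_def] s _ \<epsilon>(2), of k] b
    show "\<exists>m n w x. k \<le> m \<and> (\<forall>i<n. 0 \<le> w i \<and> x i \<in> F) \<and>
      (\<forall>i<n. (\<Sum>j<n. w j * howroyd_kernel s (2 ^ m *\<^sub>R (x i - x j))) \<le> 2 powr s) \<and>
      2 powr ((b + \<epsilon>) * real m) < (\<Sum>i<n::nat. w i)"
      by auto
  qed
  then obtain m n w x where
      mk: "\<And>k. k \<le> m k"
    and w: "\<And>k i. i < n k \<Longrightarrow> 0 \<le> w k i"
    and x: "\<And>k i. i < n k \<Longrightarrow> x k i \<in> F"
    and row: "\<And>k i. i < n k \<Longrightarrow> (\<Sum>j<n k. w k j * howroyd_kernel s (2 ^ m k *\<^sub>R (x k i - x k j))) \<le> 2 powr s"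
    and W: "\<And>k. 2 powr ((b + \<epsilon>) * real (m k)) < (\<Sum>i<n k::nat. w k i)"
    unfolding choice_iff by blast
  define W' where "W' k = (\<Sum>i<n k. w k i)" for k
  have Wpos: "0 < W' k" for k
    unfolding W'_def using W[of k] by (rule less_trans[rotated]) simp
  define r where "r k = 2 powr (- (H * real (m k)))" for k
  have rpos: "0 < r k" for k by (simp add: r_def)
  define near where "near k i j = {\<omega> \<in> space M. dist (X (x k i) \<omega>) (X (x k j) \<omega>) \<le> 4 * r k}" for k i j
  have near_meas [measurable]: "near k i j \<in> sets M" for k i j
    unfolding near_def by measurable
  define energy where "energy k \<omega> = (\<Sum>i<n k. \<Sum>j<n k. w k i * w k j * indicator (near k i j) \<omega>)" for k \<omega>
  have int: "integrable M (\<lambda>\<omega>. w k i * w k j * indicator (near k i j) \<omega>)" for k i j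
    by (intro integrable_mult_right integrable_real_indicator near_meas) (simp add: emeasure_eq_measure)
  have energy_int: "integrable M (energy k)" for k
    unfolding energy_def by (intro Bochner_Integration.integrable_sum int)
  define C where "C = exp (1 / 2) * 4 ^ CARD('d) * 2 powr s"
  have C: "0 < C" by (simp add: C_def)
  \<comment> \<open>The row bound absorbs one of the two sums over weights, so the mean energy is
    linear in W' although the energy is quadratic in the weights.\<close>
  have energy_mean: "expectation (energy k) \<le> C * W' k" for k
  proof -
    have "expectation (energy k) = (\<Sum>i<n k. \<Sum>j<n k. w k i * w k j * prob (near k i j))"
      unfolding energy_def
      by (subst Bochner_Integration.integral_sum, intro Bochner_Integration.integrable_sum int,
          intro sum.cong refl, subst Bochner_Integration.integral_sum, rule int, intro sum.cong refl) simp
    also have "\<dots> \<le> (\<Sum>i<n k. \<Sum>j<n k. w k i * w k j *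
        (exp (1 / 2) * 4 ^ CARD('d) * howroyd_kernel s (2 ^ m k *\<^sub>R (x k i - x k j))))"
      unfolding near_def r_def s_def using w
      by (intro sum_mono mult_left_mono fbm_small_ball_le_kernel[OF H X]) auto
    also have "\<dots> = (\<Sum>i<n k. w k i * (exp (1 / 2) * 4 ^ CARD('d)) *
        (\<Sum>j<n k. w k j * howroyd_kernel s (2 ^ m k *\<^sub>R (x k i - x k j))))"
      unfolding sum_distrib_left by (intro sum.cong refl) (simp only: mult_ac)
    also have "\<dots> \<le> (\<Sum>i<n k. w k i * (exp (1 / 2) * 4 ^ CARD('d)) * 2 powr s)"
      using w row by (intro sum_mono mult_left_mono) auto
    also have "\<dots> = C * W' k"
      unfolding W'_def C_def sum_distrib_left by (intro sum.cong refl) (simp only: mult_ac)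
    finally show ?thesis .
  qed
  define bad where "bad k = {\<omega> \<in> space M. 2 powr (\<epsilon> * real (m k)) * W' k \<le> energy k \<omega>}" for k
  have bad_prob: "prob (bad k) \<le> C * (2 powr (- \<epsilon>)) ^ k" for k
  proof -
    have "prob (bad k) \<le> expectation (energy k) / (2 powr (\<epsilon> * real (m k)) * W' k)"
      unfolding bad_def
    proof (rule integral_Markov_inequality_measure[OF energy_int, of "{}"])
      show "AE \<omega> in M. 0 \<le> energy k \<omega>"
        unfolding energy_def using w by (intro AE_I2 sum_nonneg) auto
    qed (use Wpos in auto)
    also have "\<dots> \<le> C * W' k / (2 powr (\<epsilon> * real (m k)) * W' k)"
      using energy_mean Wpos[of k] by (intro divide_right_mono) auto
    also have "\<dots> = C * 2 powr (- (\<epsilon> * real (m k)))"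
      using Wpos[of k] by (simp add: powr_minus field_simps)
    also have "\<dots> \<le> C * 2 powr (- (\<epsilon> * real k))"
      using C \<epsilon> mk[of k] by (intro mult_left_mono powr_mono) auto
    also have "2 powr (- (\<epsilon> * real k)) = (2 powr (- \<epsilon>)) ^ k"
      by (simp add: powr_power mult_ac)
    finally show ?thesis .
  qed
  have "AE \<omega> in M. eventually (\<lambda>k. \<omega> \<in> space M - bad k) sequentially"
  proof (rule borel_cantelli_AE1)
    show "bad k \<in> sets M" for k
      unfolding bad_def energy_def by measurable
    show "summable (\<lambda>k. prob (bad k))"
    proof (rule summable_comparison_test')
      show "summable (\<lambda>k. C * (2 powr (- \<epsilon>)) ^ k)"
        using \<epsilon> by (intro summable_mult summable_geometric) (simp add: powr_less_one)
      show "norm (prob (bad k)) \<le> C * (2 powr (- \<epsilon>)) ^ k" for k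
        using bad_prob[of k] by simp
    qed
  qed (simp add: emeasure_eq_measure)
  then show ?thesis
  proof eventually_elim
    case (elim \<omega>)
    show ?case
    proof (intro allI impI)
      fix G assume G: "bounded G" "(\<lambda>t. X t \<omega>) ` F \<subseteq> G"
      show "ereal (b / H) \<le> upper_box_dim G"
      proof (rule upper_box_dim_ge)
        have "r \<longlonglongrightarrow> 0"
        proof (rule tendsto_sandwich[OF _ _ tendsto_const])
          show "(\<lambda>k. (2 powr (- H)) ^ k) \<longlonglongrightarrow> 0"
            using H by (intro LIMSEQ_realpow_zero) (auto simp: powr_less_one)
          have "r k \<le> 2 powr (- (H * real k))" for k
            unfolding r_def using H mk[of k] by (intro powr_mono) auto
          then show "\<forall>\<^sub>F k in sequentially. r k \<le> (2 powr (- H)) ^ k"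
            by (simp add: powr_power mult_ac)
        qed (intro always_eventually allI less_imp_le rpos)
        then show "filterlim r (at_right 0) sequentially"
          by (simp add: filterlim_at rpos less_imp_neq[OF rpos, symmetric])
        show "\<forall>\<^sub>F k in sequentially. b / H * ln (1 / r k) \<le> ln (real (packing_number (r k) G))"
          using elim
        proof eventually_elim
          case (elim k)
          let ?N = "real (packing_number (r k) G)"
          have lt: "energy k \<omega> < 2 powr (\<epsilon> * real (m k)) * W' k"
            using elim by (auto simp: bad_def)
          have "(W' k)\<^sup>2 \<le> ?N * energy k \<omega>"
          proof -
            have "energy k \<omega> = (\<Sum>i<n k. \<Sum>j<n k. w k i * w k j *
                of_bool (dist (X (x k i) \<omega>) (X (x k j) \<omega>) \<le> 4 * r k))"
              unfolding energy_def using elim by (intro sum.cong refl) (auto simp: near_def)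
            moreover have "X (x k i) \<omega> \<in> G" if "i < n k" for i
              using G(2) x[OF that] by blast
            ultimately show ?thesis
              unfolding W'_def using w by (simp only: power2_sum_le_packing_number_energy[OF G(1) rpos])
          qed
          also have "\<dots> \<le> ?N * (2 powr (\<epsilon> * real (m k)) * W' k)"
            using lt by (intro mult_left_mono) auto
          finally have "W' k \<le> ?N * 2 powr (\<epsilon> * real (m k))"
            using Wpos[of k] by (simp add: power2_eq_square mult.assoc[symmetric])
          then have "2 powr ((b + \<epsilon>) * real (m k)) < ?N * 2 powr (\<epsilon> * real (m k))"
            using W[of k] by (simp add: W'_def)
          also have "2 powr ((b + \<epsilon>) * real (m k)) = 2 powr (b * real (m k)) * 2 powr (\<epsilon> * real (m k))"
            by (simp add: powr_add[symmetric] algebra_simps)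
          finally have N: "2 powr (b * real (m k)) < ?N" by simp
          \<comment> \<open>With r = 2^(-Hm), the count 2^(bm) is r^(-b/H).\<close>
          have "b / H * ln (1 / r k) = b * real (m k) * ln 2"
            using H by (simp add: r_def powr_minus_divide ln_powr)
          also have "\<dots> = ln (2 powr (b * real (m k)))" by (simp add: ln_powr)
          also have "\<dots> \<le> ln ?N"
          proof -
            have "0 < ?N" using N by (rule less_trans[rotated]) simp
            then show ?thesis using N by (subst ln_le_cancel_iff) auto
          qed
          finally show ?case .
        qed
      qed
    qed
  qed
qed

section \<open>The Baire category argument\<close>

lemma howroyd_measure_le_suminf:
  "A \<subseteq> (\<Union>k. G k) \<Longrightarrow> howroyd_measure \<alpha> s A \<le> (\<Sum>k. howroyd_premeasure \<alpha> s (G k))"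
  unfolding howroyd_measure_def by (intro Inf_lower CollectI exI[of _ G] conjI refl)

lemma howroyd_measure_mono:
  assumes "A \<subseteq> B"
  shows "howroyd_measure \<alpha> s A \<le> howroyd_measure \<alpha> s B"
  unfolding howroyd_measure_def[of \<alpha> s B]
proof (rule Inf_greatest, elim CollectE exE conjE)
  fix z and G :: "nat \<Rightarrow> 'a set"
  assume "z = (\<Sum>k. howroyd_premeasure \<alpha> s (G k))" "B \<subseteq> (\<Union>k. G k)"
  then show "howroyd_measure \<alpha> s A \<le> z"
    using howroyd_measure_le_suminf[OF order_trans[OF assms]] by simp
qed

lemma howroyd_premeasure_empty: "howroyd_premeasure \<alpha> s {} = 0"
  by (simp add: howroyd_premeasure_eq_INF howroyd_sup_def howroyd_packing_def bot_ennreal)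

lemma howroyd_measure_le_premeasure: "howroyd_measure \<alpha> s F \<le> howroyd_premeasure \<alpha> s F"
proof -
  define G where "G k = (if k = 0 then F else {})" for k :: nat
  have "howroyd_measure \<alpha> s F \<le> (\<Sum>k. howroyd_premeasure \<alpha> s (G k))"
    by (rule howroyd_measure_le_suminf) (auto simp: G_def)
  also have "\<dots> = (\<Sum>k\<in>{0}. howroyd_premeasure \<alpha> s (G k))"
    by (rule suminf_finite) (auto simp: G_def howroyd_premeasure_empty)
  finally show ?thesis by (simp add: G_def)
qed

lemma howroyd_measure_empty: "howroyd_measure \<alpha> s {} = 0"
  using howroyd_measure_le_premeasure[of \<alpha> s "{}"] by (simp add: howroyd_premeasure_empty)

text \<open>Covers of the k-th set with total below e/2^(k+1) are merged into one sequence through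
  \<open>prod_decode\<close>.\<close>

lemma howroyd_measure_UN_null:
  fixes A :: "nat \<Rightarrow> 'a::euclidean_space set"
  assumes null: "\<And>k. howroyd_measure \<alpha> s (A k) = 0"
  shows "howroyd_measure \<alpha> s (\<Union>k. A k) = 0"
proof -
  have "howroyd_measure \<alpha> s (\<Union>k. A k) \<le> 0 + ennreal e" if e: "0 < e" for e
  proof -
    have "\<exists>G. A k \<subseteq> (\<Union>l. G l) \<and> (\<Sum>l. howroyd_premeasure \<alpha> s (G l)) < ennreal (e * (1 / 2) ^ Suc k)" for k
    proof -
      have "howroyd_measure \<alpha> s (A k) < ennreal (e * (1 / 2) ^ Suc k)"
        using null[of k] e by (simp add: ennreal_zero_less_mult_iff)
      then show ?thesis
        unfolding howroyd_measure_def Inf_less_iff by blast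
    qed
    then have "\<forall>k. \<exists>G. A k \<subseteq> (\<Union>l. G l) \<and>
        (\<Sum>l. howroyd_premeasure \<alpha> s (G l)) < ennreal (e * (1 / 2) ^ Suc k)" ..
    from choice[OF this] obtain G where G: "\<forall>k. A k \<subseteq> (\<Union>l. G k l) \<and>
        (\<Sum>l. howroyd_premeasure \<alpha> s (G k l)) < ennreal (e * (1 / 2) ^ Suc k)" ..
    define G' where "G' p = (case prod_decode p of (k, l) \<Rightarrow> G k l)" for p
    have "(\<Union>k. A k) \<subseteq> (\<Union>p. G' p)"
    proof
      fix z assume "z \<in> (\<Union>k. A k)"
      then obtain k l where "z \<in> G k l" using G by blast
      then have "z \<in> G' (prod_encode (k, l))" by (simp add: G'_def)
      then show "z \<in> (\<Union>p. G' p)" by blast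
    qed
    then have "howroyd_measure \<alpha> s (\<Union>k. A k) \<le> (\<Sum>p. howroyd_premeasure \<alpha> s (G' p))"
      by (rule howroyd_measure_le_suminf)
    also have "\<dots> = (\<Sum>p. (\<lambda>(k, l). howroyd_premeasure \<alpha> s (G k l)) (prod_decode p))"
      by (intro suminf_cong) (auto simp: G'_def split: prod.splits)
    also have "\<dots> = (\<Sum>k. \<Sum>l. howroyd_premeasure \<alpha> s (G k l))"
      by (rule suminf_ennreal_2dimen[where f = "\<lambda>(k, l). howroyd_premeasure \<alpha> s (G k l)"]) simp
    also have "\<dots> \<le> (\<Sum>k. ennreal (e * (1 / 2) ^ Suc k))"
      using G by (intro suminf_le less_imp_le) simp_all
    also have "\<dots> = ennreal (e * 1)"
    proof (rule suminf_ennreal_eq)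
      show "(\<lambda>k. e * (1 / 2) ^ Suc k) sums (e * 1)"
        by (rule sums_mult[OF power_half_series])
      show "0 \<le> e * (1 / 2) ^ Suc k" for k
        using e by (intro mult_nonneg_nonneg) auto
    qed
    finally show ?thesis unfolding mult_1_right add_0_left .
  qed
  note bound = this
  have "howroyd_measure \<alpha> s (\<Union>k. A k) \<le> 0"
    by (rule ennreal_le_epsilon) (rule bound)
  then show ?thesis by simp
qed

section \<open>Category in closed subsets of the space of sequences\<close>

lemma completely_metrizable_Baire_space:
  "completely_metrizable_space (euclidean :: (nat \<Rightarrow> nat) topology)"
proof -
  have "euclidean = product_topology (\<lambda>_::nat. euclidean :: nat topology) UNIV"
    by (simp add: euclidean_product_topology)
  moreover have "(euclidean :: nat topology) = discrete_topology UNIV"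
    by (simp add: topology_eq Topological_Spaces.open_discrete flip: open_openin)
  ultimately show ?thesis
    by (simp add: completely_metrizable_space_product_topology completely_metrizable_space_discrete_topology)
qed

text \<open>A closed subspace of a completely metrizable space is completely metrizable, so Baire's
  theorem applies inside \<open>T\<close>: otherwise \<open>T\<close> would be a countable union of
  closed sets with empty relative interior.\<close>

lemma Baire_space_closed_cover:
  fixes T :: "(nat \<Rightarrow> nat) set" and C :: "nat \<Rightarrow> (nat \<Rightarrow> nat) set"
  assumes "closed T" "T \<noteq> {}" and C: "\<And>k. closed (C k)" "T \<subseteq> (\<Union>k. C k)"
  shows "\<exists>k U. open U \<and> U \<inter> T \<noteq> {} \<and> U \<inter> T \<subseteq> C k"
proof (rule ccontr)
  assume none: "\<not> ?thesis"
  let ?X = "top_of_set T"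
  have "?X interior_of (\<Union>(range (\<lambda>k. T \<inter> C k))) = {}"
  proof (rule Baire_category_alt)
    show "completely_metrizable_space ?X \<or> locally_compact_space ?X \<and> regular_space ?X"
      using completely_metrizable_Baire_space \<open>closed T\<close>
      by (auto intro!: completely_metrizable_space_closedin)
    fix S assume "S \<in> range (\<lambda>k. T \<inter> C k)"
    then obtain k where S: "S = T \<inter> C k" by blast
    have "?X interior_of S = {}"
    proof (rule ccontr)
      assume "?X interior_of S \<noteq> {}"
      then obtain W where W: "openin ?X W" "W \<noteq> {}" "W \<subseteq> S"
        by (metis interior_of_subset openin_interior_of)
      then obtain U where "open U" "W = T \<inter> U" by (auto simp: openin_open)
      with W S none show False by (metis Int_commute le_inf_iff)
    qed
    then show "closedin ?X S \<and> ?X interior_of S = {}"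
      using C(1) S by (auto simp: closedin_closed_Int)
  qed simp
  moreover have "\<Union>(range (\<lambda>k. T \<inter> C k)) = T" using C(2) by blast
  moreover have "?X interior_of T = T"
    by (metis interior_of_topspace topspace_euclidean_subtopology)
  ultimately show False using \<open>T \<noteq> {}\<close> by simp
qed

lemma closed_part_with_positive_measure:
  fixes f :: "(nat \<Rightarrow> nat) \<Rightarrow> 'a::euclidean_space"
  assumes pos: "howroyd_measure \<alpha> s (range f) \<noteq> 0"
  obtains T where "closed T" "T \<noteq> {}"
    "\<And>U. open U \<Longrightarrow> U \<inter> T \<noteq> {} \<Longrightarrow> howroyd_measure \<alpha> s (f ` (U \<inter> T)) \<noteq> 0"
proof -
  obtain B :: "(nat \<Rightarrow> nat) set set" where B: "countable B" "topological_basis B"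
    using ex_countable_basis by blast
  \<comment> \<open>The empty set is added so that \<open>from_nat_into\<close> enumerates a
    nonempty family.\<close>
  define Z where "Z = insert {} {V \<in> B. howroyd_measure \<alpha> s (f ` V) = 0}"
  have Z: "countable Z" "Z \<noteq> {}" using B by (auto simp: Z_def)
  have Znull: "howroyd_measure \<alpha> s (f ` V) = 0" if "V \<in> Z" for V
    using that by (auto simp: Z_def howroyd_measure_empty)
  have Zopen: "open V" if "V \<in> Z" for V
    using that topological_basis_open[OF B(2)] by (auto simp: Z_def)
  define T where "T = - \<Union>Z"
  have "closed T" unfolding T_def closed_Compl using Zopen by (simp add: closed_def open_Union)
  \<comment> \<open>Outside \<open>T\<close> the image of \<open>U\<close> is covered by countably
    many null images, so nullity passes from the part inside \<open>T\<close> to all of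
    \<open>U\<close>. A basic neighbourhood of a point of \<open>T\<close> inside such a
    \<open>U\<close> would therefore belong to \<open>Z\<close>, a contradiction.\<close>
  have key: "howroyd_measure \<alpha> s (f ` U) = 0" if "howroyd_measure \<alpha> s (f ` (U \<inter> T)) = 0" for U
  proof -
    define A where "A k = (case k of 0 \<Rightarrow> f ` (U \<inter> T) | Suc l \<Rightarrow> f ` from_nat_into Z l)" for k
    have "howroyd_measure \<alpha> s (A k) = 0" for k
      using that Znull[OF from_nat_into[OF Z(2)]] by (simp add: A_def split: nat.split)
    then have "howroyd_measure \<alpha> s (\<Union>k. A k) = 0"
      by (rule howroyd_measure_UN_null)
    moreover have "f ` U \<subseteq> (\<Union>k. A k)"
    proof
      fix z assume "z \<in> f ` U"
      then obtain u where u: "u \<in> U" "z = f u" by blast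
      show "z \<in> (\<Union>k. A k)"
      proof (cases "u \<in> T")
        case True
        then have "z \<in> A 0" using u by (simp add: A_def)
        then show ?thesis by blast
      next
        case False
        then obtain V where "V \<in> Z" "u \<in> V" by (auto simp: T_def)
        moreover obtain l where "from_nat_into Z l = V"
          using from_nat_into_surj[OF Z(1) \<open>V \<in> Z\<close>] by blast
        ultimately have "z \<in> A (Suc l)" using u by (simp add: A_def)
        then show ?thesis by blast
      qed
    qed
    ultimately show ?thesis
      using howroyd_measure_mono[of "f ` U" "\<Union>k. A k" \<alpha> s] by simp
  qed
  have "T \<noteq> {}"
  proof
    assume "T = {}"
    then have "howroyd_measure \<alpha> s (f ` (UNIV \<inter> T)) = 0"
      by (simp add: howroyd_measure_empty)
    with key[of UNIV] pos show False by simp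
  qed
  moreover have "howroyd_measure \<alpha> s (f ` (U \<inter> T)) \<noteq> 0" if U: "open U" "U \<inter> T \<noteq> {}" for U
  proof
    assume null: "howroyd_measure \<alpha> s (f ` (U \<inter> T)) = 0"
    obtain u where u: "u \<in> U" "u \<in> T" using U(2) by blast
    obtain V where V: "V \<in> B" "u \<in> V" "V \<subseteq> U"
      using topological_basisE[OF B(2) U(1) u(1)] by blast
    have "howroyd_measure \<alpha> s (f ` V) \<le> howroyd_measure \<alpha> s (f ` U)"
      using V by (intro howroyd_measure_mono) auto
    then have "V \<in> Z"
      using key[OF null] V by (simp add: Z_def)
    then show False using u V by (auto simp: T_def)
  qed
  ultimately show ?thesis using that \<open>closed T\<close> by blast
qed

text \<open>The cover of the image depends on \<omega>, so the null set must be fixed first. It is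
  taken over the countably many basic open sets meeting \<open>T\<close>; for each path Baire's
  theorem then selects one of them.\<close>

lemma AE_packing_dim_fbm_ge:
  fixes X :: "real ^ 'n \<Rightarrow> 'w \<Rightarrow> real ^ 'd"
  assumes H: "0 < H" and X: "fractional_brownian_motion H M X" and E: "analytic_set E"
    and pos: "howroyd_measure \<alpha> (H * real CARD('d)) E \<noteq> 0" and b: "0 < b" "b < \<alpha>"
  shows "AE \<omega> in M. ereal (b / H) \<le> packing_dim ((\<lambda>t. X t \<omega>) ` E)"
proof -
  define s where "s = H * real CARD('d)"
  have "E \<noteq> {}" using pos howroyd_measure_empty by metis
  then obtain f :: "(nat \<Rightarrow> nat) \<Rightarrow> real ^ 'n" where f: "continuous_on UNIV f" "range f = E"
    using E by (auto simp: analytic_set_def)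
  obtain T where T: "closed T" "T \<noteq> {}"
    and T_pos: "\<And>U. open U \<Longrightarrow> U \<inter> T \<noteq> {} \<Longrightarrow> howroyd_measure \<alpha> s (f ` (U \<inter> T)) \<noteq> 0"
  proof (rule closed_part_with_positive_measure)
    show "howroyd_measure \<alpha> s (range f) \<noteq> 0" using pos unfolding f(2) s_def .
  next
    fix T assume "closed T" "T \<noteq> {}"
      "\<And>U. open U \<Longrightarrow> U \<inter> T \<noteq> {} \<Longrightarrow> howroyd_measure \<alpha> s (f ` (U \<inter> T)) \<noteq> 0"
    then show thesis by (rule that)
  qed
  obtain B :: "(nat \<Rightarrow> nat) set set" where B: "countable B" "topological_basis B"
    using ex_countable_basis by blast
  have "AE \<omega> in M. \<forall>V\<in>{V \<in> B. V \<inter> T \<noteq> {}}. \<forall>G. bounded G \<longrightarrow>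
      (\<lambda>t. X t \<omega>) ` f ` (V \<inter> T) \<subseteq> G \<longrightarrow> ereal (b / H) \<le> upper_box_dim G"
  proof (subst AE_ball_countable, use B in simp, intro ballI)
    fix V assume V: "V \<in> {V \<in> B. V \<inter> T \<noteq> {}}"
    then have "howroyd_measure \<alpha> s (f ` (V \<inter> T)) \<noteq> 0"
      using topological_basis_open[OF B(2)] by (intro T_pos) auto
    then have "howroyd_premeasure \<alpha> s (f ` (V \<inter> T)) \<noteq> 0"
      using howroyd_measure_le_premeasure[of \<alpha> s "f ` (V \<inter> T)"] by auto
    then show "AE \<omega> in M. \<forall>G. bounded G \<longrightarrow>
        (\<lambda>t. X t \<omega>) ` f ` (V \<inter> T) \<subseteq> G \<longrightarrow> ereal (b / H) \<le> upper_box_dim G"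
      unfolding s_def by (rule AE_fbm_upper_box_dim_ge[OF H X _ b])
  qed
  moreover have "AE \<omega> in M. continuous_on UNIV (\<lambda>t. X t \<omega>)"
    using X by (simp add: fractional_brownian_motion_def)
  ultimately show ?thesis
  proof eventually_elim
    case (elim \<omega>)
    have cont: "continuous_on UNIV (\<lambda>u. X (f u) \<omega>)"
      using continuous_on_compose2[OF elim(2) f(1)] by simp
    have "ereal (b / H) \<le> (SUP k. upper_box_dim (G k))"
      if G: "(\<lambda>t. X t \<omega>) ` E \<subseteq> (\<Union>k. G k)" "\<And>k. bounded (G k)" for G :: "nat \<Rightarrow> (real ^ 'd) set"
    proof -
      \<comment> \<open>Closures make the pulled-back sets closed by continuity; bounded sets lose
        nothing, as closure does not raise the upper box dimension.\<close>
      define C where "C k = (\<lambda>u. X (f u) \<omega>) -` closure (G k)" for k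
      have "closed (C k)" for k
        unfolding C_def using cont by (intro closed_vimage) auto
      moreover have "T \<subseteq> (\<Union>k. C k)"
      proof
        fix u assume "u \<in> T"
        have "X (f u) \<omega> \<in> (\<Union>k. G k)" using G(1) f(2) by blast
        then obtain k where "X (f u) \<omega> \<in> G k" by blast
        then have "u \<in> C k" using closure_subset by (auto simp: C_def)
        then show "u \<in> (\<Union>k. C k)" by blast
      qed
      ultimately have "\<exists>k U. open U \<and> U \<inter> T \<noteq> {} \<and> U \<inter> T \<subseteq> C k"
        by (rule Baire_space_closed_cover[OF T])
      then obtain k U where U: "open U" "U \<inter> T \<noteq> {}" "U \<inter> T \<subseteq> C k"
        by (elim exE conjE)
      obtain u where u: "u \<in> U" "u \<in> T" using U(2) by blast
      obtain V where V: "V \<in> B" "u \<in> V" "V \<subseteq> U"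
        using topological_basisE[OF B(2) U(1) u(1)] by blast
      have "V \<in> {V \<in> B. V \<inter> T \<noteq> {}}" using V u by blast
      moreover have "(\<lambda>t. X t \<omega>) ` f ` (V \<inter> T) \<subseteq> closure (G k)"
        using V U(3) by (auto simp: C_def)
      moreover have "bounded (closure (G k))" by (rule bounded_closure[OF G(2)])
      ultimately have "ereal (b / H) \<le> upper_box_dim (closure (G k))"
        using elim(1) by simp
      also have "\<dots> \<le> upper_box_dim (G k)"
        by (rule upper_box_dim_closure_le[OF G(2)])
      also have "\<dots> \<le> (SUP k. upper_box_dim (G k))"
        by (rule SUP_upper) simp
      finally show ?thesis .
    qed
    then show ?case
      unfolding packing_dim_def using \<open>E \<noteq> {}\<close> by (auto intro!: Inf_greatest)
  qed
qed

section \<open>The upper bound for all exponents at once, and the dimension formula\<close>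

lemma AE_packing_dim_fbm_le:
  fixes X :: "real ^ 'n \<Rightarrow> 'w \<Rightarrow> real ^ 'd"
  assumes H: "0 < H" and X: "fractional_brownian_motion H M X"
  shows "AE \<omega> in M. \<forall>\<alpha>>0. howroyd_measure \<alpha> (H * real CARD('d)) E = 0 \<longrightarrow>
    packing_dim ((\<lambda>t. X t \<omega>) ` E) \<le> ereal (\<alpha> / H)"
proof -
  \<comment> \<open>Hoelder exponents increasing to H from H/2. Each satisfies d \<gamma> < Hd, and
    the countably many Hoelder events do not involve \<alpha>, so one null set serves every
    \<alpha>.\<close>
  define \<gamma> where "\<gamma> n = H * (1 - 1 / (real n + 2))" for n
  have \<gamma>: "0 < \<gamma> n" "\<gamma> n < H" for n
  proof -
    have "1 / (real n + 2) < 1" "0 < 1 / (real n + 2)" by auto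
    then show "0 < \<gamma> n" "\<gamma> n < H" using H by (simp_all add: \<gamma>_def)
  qed
  have "(\<lambda>n. H * (1 - 1 / (real n + 2))) \<longlonglongrightarrow> H * (1 - 0)"
  proof (intro tendsto_intros tendsto_divide_0[OF tendsto_const] filterlim_at_top_imp_at_infinity)
    show "filterlim (\<lambda>n. real n + 2) at_top sequentially"
      by (rule filterlim_at_top_mono[OF filterlim_real_sequentially]) simp
  qed
  then have \<gamma>_lim: "\<gamma> \<longlonglongrightarrow> H" by (simp add: \<gamma>_def[abs_def])
  have "AE \<omega> in M. \<forall>n R. \<exists>A>0. \<forall>x\<in>cball 0 R. \<forall>y\<in>cball 0 R.
      dist (X x \<omega>) (X y \<omega>) \<le> A * dist x y powr \<gamma> n"
    unfolding AE_all_countable using AE_fbm_Hoelder[OF H X] \<gamma> by blast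
  then show ?thesis
  proof eventually_elim
    case (elim \<omega>)
    show ?case
    proof (intro allI impI)
      fix \<alpha> :: real
      assume \<alpha>: "0 < \<alpha>" and null: "howroyd_measure \<alpha> (H * real CARD('d)) E = 0"
      have le: "packing_dim ((\<lambda>t. X t \<omega>) ` E) \<le> ereal (\<alpha> / \<gamma> n)" for n
        by (rule packing_dim_image_le[OF \<gamma>(1) _ \<alpha> null]) (use elim \<gamma> in \<open>auto simp: mult.commute\<close>)
      have lim: "(\<lambda>n. ereal (\<alpha> / \<gamma> n)) \<longlonglongrightarrow> ereal (\<alpha> / H)"
        using H by (intro tendsto_ereal tendsto_divide tendsto_const \<gamma>_lim) simp
      show "packing_dim ((\<lambda>t. X t \<omega>) ` E) \<le> ereal (\<alpha> / H)"
        by (rule LIMSEQ_le_const[OF lim]) (use le in blast)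
    qed
  qed
qed

theorem theorem1p2:
  fixes H :: real
    and M :: "'w measure"
    and X :: "real ^ 'n \<Rightarrow> 'w \<Rightarrow> real ^ 'd"
    and E :: "(real ^ 'n) set"
  assumes "0 < H" and "H < 1"
    and "fractional_brownian_motion H M X"
    and "analytic_set E"
  shows "AE \<omega> in M.
    packing_dim ((\<lambda>t. X t \<omega>) ` E) =
      ereal (1 / H) * packing_dim_profile (H * real CARD('d)) E"
proof -
  note H = assms(1) and X = assms(3)
  define s where "s = H * real CARD('d)"
  define P where "P = packing_dim_profile s E"
  have cancel: "ereal (1 / H) * (ereal H * z) = z" for z
    using H by (simp add: mult.assoc[symmetric])
  \<comment> \<open>Rational exponents keep the number of exceptional sets countable and are still
    dense below the deterministic value \<open>P\<close>.\<close>
  have lower: "AE \<omega> in M. \<forall>q::rat. 0 < real_of_rat q \<longrightarrow> ereal (real_of_rat q) < P \<longrightarrow>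
      ereal (real_of_rat q / H) \<le> packing_dim ((\<lambda>t. X t \<omega>) ` E)"
    unfolding AE_all_countable
  proof
    fix q :: rat
    show "AE \<omega> in M. 0 < real_of_rat q \<longrightarrow> ereal (real_of_rat q) < P \<longrightarrow>
      ereal (real_of_rat q / H) \<le> packing_dim ((\<lambda>t. X t \<omega>) ` E)"
    proof (cases "0 < real_of_rat q \<and> ereal (real_of_rat q) < P")
      case True
      \<comment> \<open>The lower bound needs a strict gap between its exponent and an \<alpha> of
        positive measure.\<close>
      then obtain \<alpha> where \<alpha>: "real_of_rat q < \<alpha>" "ereal \<alpha> < P"
        using ereal_dense2[of "ereal (real_of_rat q)" P] by auto
      have "0 < \<alpha>" using True \<alpha>(1) by linarith
      have "howroyd_measure \<alpha> s E \<noteq> 0"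
      proof
        assume "howroyd_measure \<alpha> s E = 0"
        then have "P \<le> ereal \<alpha>"
          unfolding P_def packing_dim_profile_def using \<open>0 < \<alpha>\<close> by (intro Inf_lower) auto
        with \<alpha> show False by simp
      qed
      then show ?thesis
        using AE_packing_dim_fbm_ge[OF H X assms(4), of \<alpha> "real_of_rat q"] True \<alpha>
        by (simp add: s_def)
    qed auto
  qed
  show ?thesis
    using lower AE_packing_dim_fbm_le[OF H X, of E]
  proof eventually_elim
    case (elim \<omega>)
    define D where "D = packing_dim ((\<lambda>t. X t \<omega>) ` E)"
    have D: "0 \<le> ereal H * D"
      unfolding D_def using H packing_dim_nonneg by (intro ereal_0_le_mult) auto
    have scale: "ereal H * ereal (\<alpha> / H) = ereal \<alpha>" for \<alpha>
      using H by simp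
    have "ereal H * D \<le> P"
      unfolding P_def packing_dim_profile_def
    proof (rule Inf_greatest, elim CollectE exE conjE)
      fix z \<alpha> assume z: "z = ereal \<alpha>" "0 < \<alpha>" "howroyd_measure \<alpha> s E = 0"
      then have "D \<le> ereal (\<alpha> / H)" using elim(2) by (simp add: D_def s_def)
      then have "ereal H * D \<le> ereal H * ereal (\<alpha> / H)"
        using H by (intro ereal_mult_left_mono) auto
      then show "ereal H * D \<le> z" unfolding scale z(1) .
    qed
    \<comment> \<open>A rational strictly between H D and \<open>P\<close>, positive because D >= 0,
      would contradict the lower bound for that rational.\<close>
    moreover have "P \<le> ereal H * D"
    proof (rule ccontr)
      assume "\<not> P \<le> ereal H * D"
      then have "ereal H * D < P" by simp
      then obtain q where q: "ereal H * D < ereal (real_of_rat q)" "ereal (real_of_rat q) < P"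
        using ereal_dense3 by blast
      have "0 < ereal (real_of_rat q)" using D q(1) by (rule le_less_trans)
      then have "0 < real_of_rat q" by simp
      then have "ereal (real_of_rat q / H) \<le> D"
        using elim(1) q(2) unfolding D_def by blast
      then have "ereal H * ereal (real_of_rat q / H) \<le> ereal H * D"
        using H by (intro ereal_mult_left_mono) auto
      then show False using q(1) unfolding scale by simp
    qed
    ultimately have "ereal H * D = P" by (rule antisym)
    then show ?case
      using cancel[of D] unfolding D_def P_def s_def by simp
  qed
qed

end
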